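(* Let $T$ be a tree with $n\ge 3$ vertices, $t$ twigs and $l$ leaves. If $T$ contains $T^*$ as a subgraph, then $m(T)=\infty$. If $T$ is a star, then $m(T)=2$. Otherwise, $m(T)=2n+2t-2l-4$.
   Context: $T^*$ is the tree consisting of three paths of length $3$ sharing one common endpoint (a central vertex with three pendant paths of three further vertices each; ten vertices in total). A twig of $T$ is a vertex $v$ with $d(v)\ge 2$ such that at least $d(v)-1$ of its neighbours are leaves. For a connected graph $G$: a cat sequence is any sequence $c_1,\ldots,c_s$ of vertices of $G$; a mouse sequence is a sequence $m_1,\ldots,m_s$ of vertices with $m_im_{i+1}\in E(G)$ for $1\le i\le s-1$, and it beats the cat sequence if $m_i\neq c_i$ for all $i$. The mouse can survive to time $s$ on $G$ if every cat sequence of length $s$ is beaten by some mouse sequence. $m(G)$ is the least positive integer $s$ such that the mouse cannot survive to time $s$ on $G$, and $m(G)=\infty$ if no such $s$ exists. *)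

theory Defs
  imports "Graph_Theory.Graph_Theory" "HOL-Library.Extended_Nat"
begin

text \<open>
  Finite simple graphs are those of the locale \<^locale>\<open>graph\<close>: finite symmetric digraphs
  without loops and parallel arcs, each undirected edge being a pair of opposite arcs.

  The library constant \<^const>\<open>Digraph_Component.tree\<close> is not suitable here: it forbids every
  directed cycle, including the closed walk u, v, u along one undirected edge, so that no
  symmetric digraph with an edge satisfies it. The cycles of the undirected graph are the
  directed ones of length at least 3.
\<close>

definition undirected_tree :: "('a, 'b) pre_digraph \<Rightarrow> bool" where
  "undirected_tree G \<longleftrightarrow>
     graph G \<and> Digraph_Component.connected G \<and>
     \<not> (\<exists>p. pre_digraph.cycle G p \<and> 3 \<le> length p)"

text \<open>In a symmetric digraph \<^const>\<open>out_degree\<close> is the degree in the undirected graph.\<close>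

definition leaves :: "('a, 'b) pre_digraph \<Rightarrow> 'a set" where
  "leaves G = {v \<in> verts G. out_degree G v = 1}"

definition twigs :: "('a, 'b) pre_digraph \<Rightarrow> 'a set" where
  "twigs G = {v \<in> verts G. 2 \<le> out_degree G v \<and>
     out_degree G v - 1 \<le> card {w \<in> leaves G. v \<rightarrow>\<^bsub>G\<^esub> w}}"

definition is_star :: "('a, 'b) pre_digraph \<Rightarrow> bool" where
  "is_star G \<longleftrightarrow> (\<exists>k. complete_bipartite_digraph 1 k G)"

text \<open>The tree \<open>T\<^sup>*\<close>, with central vertex 0.\<close>

definition tstar_edges :: "(nat \<times> nat) set" where
  "tstar_edges = {(0,1), (1,2), (2,3), (0,4), (4,5), (5,6), (0,7), (7,8), (8,9)}"

definition tstar :: "nat pair_pre_digraph" where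
  "tstar = \<lparr> pverts = {0..9}, parcs = tstar_edges \<union> tstar_edges\<inverse> \<rparr>"

text \<open>Subgraphs need not be induced, and containment is up to isomorphism.\<close>

definition contains_subgraph :: "('a, 'b) pre_digraph \<Rightarrow> ('c, 'd) pre_digraph \<Rightarrow> bool" where
  "contains_subgraph G H \<longleftrightarrow> (\<exists>S. subgraph S G \<and> digraph_iso H S)"

definition cat_sequence :: "('a, 'b) pre_digraph \<Rightarrow> 'a list \<Rightarrow> bool" where
  "cat_sequence G cs \<longleftrightarrow> set cs \<subseteq> verts G"

definition mouse_sequence :: "('a, 'b) pre_digraph \<Rightarrow> 'a list \<Rightarrow> bool" where
  "mouse_sequence G ms \<longleftrightarrow>
     set ms \<subseteq> verts G \<and> (\<forall>i. Suc i < length ms \<longrightarrow> ms ! i \<rightarrow>\<^bsub>G\<^esub> ms ! Suc i)"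

definition beats :: "'a list \<Rightarrow> 'a list \<Rightarrow> bool" where
  "beats ms cs \<longleftrightarrow> length ms = length cs \<and> (\<forall>i < length cs. ms ! i \<noteq> cs ! i)"

definition mouse_survives :: "('a, 'b) pre_digraph \<Rightarrow> nat \<Rightarrow> bool" where
  "mouse_survives G s \<longleftrightarrow>
     (\<forall>cs. cat_sequence G cs \<and> length cs = s \<longrightarrow> (\<exists>ms. mouse_sequence G ms \<and> beats ms cs))"

definition mouse_number :: "('a, 'b) pre_digraph \<Rightarrow> enat" where
  "mouse_number G =
     (if \<exists>s\<ge>1. \<not> mouse_survives G s
      then enat (LEAST s. 1 \<le> s \<and> \<not> mouse_survives G s)
      else \<infinity>)"

end

(* A mouse only ever competes with the looks of one parity, since the tree is bipartite, and both
   parities have to be cleared.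

   If T contains T*, a mouse living on T* is never caught: two of the three arms cannot be
   emptied together with the centre.

   Lower bound: a vertex with d >= 1 non-leaf neighbours has to be looked at, for each of the two
   parities, at least max(1, d - 1) times, because a mouse hiding around it can otherwise wait
   beyond one of these neighbours. Summing over all non-leaves gives 2(n + t - l - 2).

   Upper bound: without T*, all vertices have distance at most 2 from a longest path. The cat walks
   along that path (without its end vertices) and makes a detour to every twig next to it. This
   catches all mice of its own parity, as they cannot slip past the cat; the same walk backwards
   then has the right parity for the others. *)

theory Submission
  imports Defs
begin

text \<open>Why both bounds give the same number: the \<open>n - l\<close> non-leaves induce a tree,
  so the values \<open>d - 1\<close> add up to \<open>n - l - 2\<close>. Replacing
  \<open>d - 1\<close> by \<open>max(1, d - 1)\<close> adds one for each vertex with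
  \<open>d = 1\<close>, and in a tree that is not a star these vertices are exactly the twigs. The
  formula breaks down for a star because its centre has \<open>d = 0\<close>. If the spine has
  \<open>q\<close> vertices and \<open>L\<close> twigs hang next to it, then
  \<open>n - l = q + L\<close> and \<open>t = L + 2\<close>, since the two ends of the spine are
  twigs as well; the value becomes \<open>2 * (q + 2 * L)\<close>. The bounds meet vertex by vertex:
  an inner spine vertex carrying \<open>k\<close> of these twigs has \<open>d = k + 2\<close>, and
  one walk looks at it \<open>k + 1\<close> times, on arrival and after each detour. Every other
  non-leaf has \<open>d = 1\<close> and is looked at once per walk.\<close>

section \<open>Territory of the mouse\<close>

text \<open>The possible positions of a mouse that starts in \<open>S\<close> and escapes the looks \<open>cs\<close>,
  after its move following the last look.\<close>

primrec territory :: "('a \<Rightarrow> 'a \<Rightarrow> bool) \<Rightarrow> 'a set \<Rightarrow> 'a list \<Rightarrow> 'a set" where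
  "territory adj S [] = S"
| "territory adj S (c # cs) = territory adj {w. \<exists>v\<in>S - {c}. adj v w} cs"

text \<open>Only looks at one parity of time are counted, beginning with the first one if \<open>b\<close> holds.\<close>

primrec visits :: "bool \<Rightarrow> 'a \<Rightarrow> 'a list \<Rightarrow> nat" where
  "visits b v [] = 0"
| "visits b v (c # cs) = of_bool (b \<and> c = v) + visits (\<not> b) v cs"

lemma visits_True_False: "visits b v cs + visits (\<not> b) v cs = count_list cs v"
  by (induction cs arbitrary: b) (auto simp: add_ac)

lemma territory_append: "territory adj S (cs @ ds) = territory adj (territory adj S cs) ds"
  by (induction cs arbitrary: S) auto

lemma territory_Un: "territory adj (S \<union> S') cs = territory adj S cs \<union> territory adj S' cs"
proof (induction cs arbitrary: S S')
  case (Cons c cs)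
  have "{w. \<exists>v\<in>(S \<union> S') - {c}. adj v w} = {w. \<exists>v\<in>S - {c}. adj v w} \<union> {w. \<exists>v\<in>S' - {c}. adj v w}"
    by blast
  then show ?case using Cons by simp
qed simp

text \<open>\<open>ms\<close> lists the positions at the looks and \<open>v\<close> is the position
  after the final move. Writing \<open>hd (ms @ [v])\<close> covers the case without looks, where
  the walk starts at \<open>v\<close> itself.\<close>

lemma territory_iff_walk:
  "v \<in> territory adj S cs \<longleftrightarrow>
     (\<exists>ms. length ms = length cs \<and> successively adj (ms @ [v]) \<and> hd (ms @ [v]) \<in> S \<and>
           (\<forall>i < length cs. ms ! i \<noteq> cs ! i))"
proof (induction cs arbitrary: S)
  case (Cons c cs)
  show ?case (is "_ \<longleftrightarrow> ?R")
  proof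
    assume "v \<in> territory adj S (c # cs)"
    then obtain ms where ms: "length ms = length cs" "successively adj (ms @ [v])"
      "hd (ms @ [v]) \<in> {w. \<exists>u\<in>S - {c}. adj u w}" "\<forall>i < length cs. ms ! i \<noteq> cs ! i"
      using Cons.IH by auto
    then obtain u where u: "u \<in> S" "u \<noteq> c" "adj u (hd (ms @ [v]))" by auto
    show ?R
      using ms u by (intro exI[of _ "u # ms"]) (auto simp: successively_Cons nth_Cons split: nat.split)
  next
    assume ?R
    then obtain ms' where ms': "length ms' = Suc (length cs)" "successively adj (ms' @ [v])"
      "hd (ms' @ [v]) \<in> S" "\<forall>i < Suc (length cs). ms' ! i \<noteq> (c # cs) ! i" by auto
    then obtain u ms where u: "ms' = u # ms" by (cases ms') auto
    have "v \<in> territory adj {w. \<exists>u\<in>S - {c}. adj u w} cs"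
      unfolding Cons.IH using ms' u
      by (intro exI[of _ ms]) (fastforce simp: successively_Cons All_less_Suc2)
    then show "v \<in> territory adj S (c # cs)" by simp
  qed
qed simp

section \<open>Symmetric adjacency relations and the hiding strategies of the mouse\<close>

locale symmetric_graph =
  fixes V :: "'a set" and adj :: "'a \<Rightarrow> 'a \<Rightarrow> bool"
  assumes finite_V: "finite V"
    and adj_V: "adj u v \<Longrightarrow> u \<in> V"
    and adj_sym: "adj u v \<Longrightarrow> adj v u"
    and adj_irrefl: "\<not> adj v v"
begin

lemma adj_V2: "adj u v \<Longrightarrow> v \<in> V"
  using adj_V adj_sym by blast

lemma finite_nbhd: "finite {w. adj v w}"
  using finite_V adj_V2 by (auto intro: finite_subset[of _ V])

text \<open>Unless the cat looks at \<open>z\<close>, the mouse refills all the \<open>a i\<close>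
  from there; a look at \<open>z\<close> spares the two occupied \<open>b\<close>s, which feed the
  \<open>a\<close> and the \<open>c\<close> of their arms. In the other direction one look removes
  at most one of the occupied \<open>a\<close>s and \<open>c\<close>s: some \<open>a\<close> is left
  to reach \<open>z\<close>, and two of the \<open>b\<close>s still have an occupied
  neighbour.\<close>

lemma tstar_territory:
  fixes a b c :: "nat \<Rightarrow> 'a"
  assumes adj: "\<And>i. i < 3 \<Longrightarrow> adj z (a i) \<and> adj (a i) (b i) \<and> adj (b i) (c i)"
    and dist: "inj_on a {..<3}" "inj_on b {..<3}" "\<And>i. i < 3 \<Longrightarrow> b i \<noteq> z"
      "\<And>i j. i < 3 \<Longrightarrow> j < 3 \<Longrightarrow> c i \<noteq> a j" "inj_on c {..<3}"
  shows "territory adj V cs \<noteq> {}"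
proof -
  \<comment> \<open>\<open>A\<close> and \<open>B\<close> hold alternately; the cat can never reduce the territory below them.\<close>
  define A where "A S \<longleftrightarrow> z \<in> S \<and> (\<exists>i<3. \<exists>j<3. i \<noteq> j \<and> b i \<in> S \<and> b j \<in> S)" for S
  define B where "B S \<longleftrightarrow> (\<forall>i<3. a i \<in> S) \<or>
    (\<exists>i<3. \<exists>j<3. i \<noteq> j \<and> {a i, a j, c i, c j} \<subseteq> S)" for S
  let ?N = "\<lambda>S x. {w. \<exists>v\<in>S - {x}. adj v w}"
  have AB: "B (?N S x)" if "A S" for S x
  proof (cases "x = z")
    case False
    then have "a i \<in> ?N S x" if "i < 3" for i using \<open>A S\<close> adj that by (auto simp: A_def)
    then show ?thesis by (auto simp: B_def)
  next
    case True
    obtain i j where ij: "i < 3" "j < 3" "i \<noteq> j" "b i \<in> S" "b j \<in> S"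
      using \<open>A S\<close> by (auto simp: A_def)
    have "b i \<in> S - {x}" "b j \<in> S - {x}" using ij dist(3) True by auto
    then have "{a i, a j, c i, c j} \<subseteq> ?N S x" using adj adj_sym ij(1,2) by blast
    then show ?thesis using ij unfolding B_def by blast
  qed
  have BA: "A (?N S x)" if "B S" for S x
  proof -
    have A_I: "A (?N S x)" if "i < 3" "j < 3" "i \<noteq> j" and k: "k < 3" "a k \<in> S - {x}"
      and "b i \<in> ?N S x" "b j \<in> ?N S x" for i j k
    proof -
      have "z \<in> ?N S x" using k adj adj_sym by blast
      then show ?thesis using that unfolding A_def by blast
    qed
    show ?thesis
    proof (cases "\<forall>i<3. a i \<in> S")
      case True
      have "\<exists>i<3. \<exists>j<3. i \<noteq> j \<and> a i \<noteq> x \<and> a j \<noteq> x"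
      proof -
        have "a 0 \<noteq> a 1" "a 0 \<noteq> a 2" "a 1 \<noteq> a 2" using inj_onD[OF dist(1)] by fastforce+
        then consider "a 0 \<noteq> x \<and> a 1 \<noteq> x" | "a 0 \<noteq> x \<and> a 2 \<noteq> x" | "a 1 \<noteq> x \<and> a 2 \<noteq> x" by metis
        then show ?thesis 
            by cases (rule exI[of _ 0], simp, rule exI[of _ 1], simp,
              rule exI[of _ 0], simp, rule exI[of _ 2], simp,
              rule exI[of _ 1], simp, rule exI[of _ 2], simp)
      qed
      then obtain i j where ij: "i < 3" "j < 3" "i \<noteq> j" "a i \<noteq> x" "a j \<noteq> x" by blast
      have "b i \<in> ?N S x" "b j \<in> ?N S x" using ij True adj by blast+
      then show ?thesis using A_I[of i j i] ij True by blast
    next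
      case False
      then obtain i j where ij: "i < 3" "j < 3" "i \<noteq> j" "{a i, a j, c i, c j} \<subseteq> S"
        using \<open>B S\<close> unfolding B_def by blast
      have ne: "a i \<noteq> a j" "c i \<noteq> c j" "c i \<noteq> a i" "c j \<noteq> a j" "c i \<noteq> a j" "c j \<noteq> a i"
        using ij dist by (auto simp: inj_on_def)
      have "a i \<in> S - {x} \<or> c i \<in> S - {x}" "a j \<in> S - {x} \<or> c j \<in> S - {x}"
        using ij ne by auto
      then have b: "b i \<in> ?N S x" "b j \<in> ?N S x" using adj adj_sym ij(1,2) by blast+
      have "a i \<in> S - {x} \<or> a j \<in> S - {x}" using ij ne by auto
      then show ?thesis using A_I[of i j] b ij by blast
    qed
  qed
  have "(A S \<or> B S) \<longrightarrow> territory adj S cs \<noteq> {}" for S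
  proof (induction cs arbitrary: S)
    case Nil
    have "z \<in> S" if "A S" using that by (simp add: A_def)
    moreover have "\<exists>i. a i \<in> S" if "B S" using that zero_less_numeral unfolding B_def by blast
    ultimately show ?case by auto
  next
    case (Cons x cs)
    then show ?case using AB BA by auto
  qed
  moreover have "B V" using adj adj_V adj_V2 unfolding B_def by blast
  ultimately show ?thesis by blast
qed

text \<open>While the cat is busy at \<open>v\<close>, the mouse hides beyond one of the non-leaf neighbours
  of \<open>v\<close>; each further visit spoils at most one of these hiding places.\<close>

lemma visits_lower_bound:
  fixes v :: 'a and cs :: "'a list"
  defines "H \<equiv> {w. adj v w \<and> (\<exists>x. adj w x \<and> x \<noteq> v)}"
  assumes deg: "2 \<le> card {w. adj v w}"
    and caught: "territory adj V cs = {}"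
  shows "1 \<le> visits b v cs \<and> card H \<le> visits b v cs + 1"
proof (rule ccontr)
  assume "\<not> ?thesis"
  then have few: "0 + visits b v cs = 0 \<or> 0 + visits b v cs + 2 \<le> card H" by auto
  let ?d = "card H"
  have finH: "finite H" unfolding H_def using finite_nbhd by (auto intro: finite_subset)
  \<comment> \<open>\<open>at_v\<close>: the mouse can be at \<open>v\<close> now, otherwise next to \<open>v\<close>; \<open>k\<close> counts the visits so far.\<close>
  define safe where "safe at_v S k \<longleftrightarrow>
    (if at_v then v \<in> S \<and> ?d \<le> card {w \<in> H. \<exists>x\<in>S. x \<noteq> v \<and> adj w x} + k + 1
     else \<exists>W. W \<subseteq> S \<and> W \<subseteq> {w. adj v w} \<and> 2 \<le> card W \<and> ?d \<le> card (W \<inter> H) + k)" for at_v S k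
  \<comment> \<open>Each look next to \<open>v\<close> spoils at most one hiding place, and if the
    following look misses \<open>v\<close>, the mouse at \<open>v\<close> spreads to all neighbours
    again; so only looks at \<open>v\<close> consume the budget, recorded in \<open>k\<close>. The
    \<open>+ 2\<close> keeps two neighbours of \<open>v\<close> occupied, so that no single look can
    prevent the return to \<open>v\<close>; as long as \<open>v\<close> is never looked at,
    \<open>deg\<close> provides these two.\<close>
  have escape: "territory adj S cs \<noteq> {}"
    if "safe at_v S k" "k + visits at_v v cs = 0 \<or> k + visits at_v v cs + 2 \<le> ?d" for at_v S k cs
    using that
  proof (induction cs arbitrary: at_v S k)
    case Nil
    then show ?case by (cases at_v) (auto simp: safe_def)
  next
    case (Cons c cs)
    let ?S' = "{w. \<exists>u\<in>S - {c}. adj u w}"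
    show ?case
    proof (cases at_v)
      case False
      then obtain W where W: "W \<subseteq> S" "W \<subseteq> {w. adj v w}" "2 \<le> card W" "?d \<le> card (W \<inter> H) + k"
        using Cons.prems(1) by (auto simp: safe_def)
      have "card (W - {c}) > 0" using W(3) by (cases "c \<in> W") (auto simp: card_Diff_singleton_if)
      then obtain w where "w \<in> W - {c}" by (metis card_gt_0_iff ex_in_conv)
      then have "v \<in> ?S'" using W adj_sym by blast
      moreover have "(W \<inter> H) - {c} \<subseteq> {w \<in> H. \<exists>x\<in>?S'. x \<noteq> v \<and> adj w x}"
        using W by (auto simp: H_def)
      then have "card ((W \<inter> H) - {c}) \<le> card {w \<in> H. \<exists>x\<in>?S'. x \<noteq> v \<and> adj w x}"
        using finH by (intro card_mono) auto
      moreover have "card (W \<inter> H) \<le> card ((W \<inter> H) - {c}) + 1"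
        by (auto simp: card_Diff_singleton_if)
      ultimately have "safe True ?S' k" using W(4) by (auto simp: safe_def)
      then show ?thesis using Cons.IH[of True ?S' k] Cons.prems(2) False by simp
    next
      case at_v: True
      show ?thesis
      proof (cases "c = v")
        case False
        have "{w. adj v w} \<subseteq> ?S'" using Cons.prems(1) at_v False by (auto simp: safe_def)
        moreover have "{w. adj v w} \<inter> H = H" by (auto simp: H_def)
        ultimately have "{w. adj v w} \<subseteq> ?S' \<and> {w. adj v w} \<subseteq> {w. adj v w} \<and>
          2 \<le> card {w. adj v w} \<and> ?d \<le> card ({w. adj v w} \<inter> H) + k"
          using deg by simp
        then have "safe False ?S' k" unfolding safe_def by (simp only: if_False) (rule exI)
        then show ?thesis using Cons.IH[of False ?S' k] Cons.prems(2) at_v False by simp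
      next
        case True
        let ?W = "{w \<in> H. \<exists>x\<in>S. x \<noteq> v \<and> adj w x}"
        have W: "?W \<subseteq> ?S'" using True adj_sym by blast
        have "?d \<le> card ?W + k + 1" using Cons.prems(1) at_v by (auto simp: safe_def)
        moreover have "k + 3 \<le> ?d" using Cons.prems(2) at_v True by auto
        moreover have "?W \<inter> H = ?W" "?W \<subseteq> {w. adj v w}" by (auto simp: H_def)
        ultimately have "?W \<subseteq> ?S' \<and> ?W \<subseteq> {w. adj v w} \<and> 2 \<le> card ?W \<and>
          ?d \<le> card (?W \<inter> H) + (k + 1)"
          using W by simp
        then have "safe False ?S' (k + 1)" unfolding safe_def by (simp only: if_False) (rule exI)
        then show ?thesis using Cons.IH[of False ?S' "k + 1"] Cons.prems(2) at_v True by simp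
      qed
    qed
  qed
  have "safe b V 0"
  proof (cases b)
    case True
    have "v \<in> V" using deg by (metis adj_V card.empty empty_Collect_eq not_numeral_le_zero)
    moreover have "{w \<in> H. \<exists>x\<in>V. x \<noteq> v \<and> adj w x} = H" using adj_V2 by (auto simp: H_def)
    ultimately show ?thesis using True by (simp add: safe_def)
  next
    case False
    have "{w. adj v w} \<inter> H = H" by (auto simp: H_def)
    then have "{w. adj v w} \<subseteq> V \<and> {w. adj v w} \<subseteq> {w. adj v w} \<and>
        2 \<le> card {w. adj v w} \<and> ?d \<le> card ({w. adj v w} \<inter> H) + 0"
      using deg adj_V2 by auto
    with False show ?thesis unfolding safe_def by (simp only: if_False) (rule exI)
  qed
  from escape[OF this few] caught show False by simp
qed

text \<open>Looks at different vertices or at different parities are different looks, so the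
  individual bounds add up; the two values of \<open>b\<close> account for the factor 2.\<close>

lemma length_lower_bound:
  assumes "set cs \<subseteq> V" "U \<subseteq> V"
    and "\<And>v b. v \<in> U \<Longrightarrow> f v \<le> visits b v cs"
  shows "2 * sum f U \<le> length cs"
proof -
  have "2 * sum f U = (\<Sum>v\<in>U. f v + f v)" by (simp add: sum_distrib_left mult_2)
  also have "\<dots> \<le> (\<Sum>v\<in>U. visits True v cs + visits (\<not> True) v cs)"
    using assms(3) by (intro sum_mono add_mono) auto
  also have "\<dots> = (\<Sum>v\<in>U. count_list cs v)" by (simp only: visits_True_False)
  also have "\<dots> \<le> (\<Sum>v\<in>V. count_list cs v)" using assms(2) finite_V by (intro sum_mono2) auto
  also have "\<dots> = length cs" using assms(1) finite_V by (rule sum_count_set)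
  finally show ?thesis .
qed

end

section \<open>Clearing a tree with a spine\<close>

text \<open>A caterpillar with hairs of length at most two: the spine is \<open>s 0, \<dots>, s (q - 1)\<close>,
  the spine vertex nearest to \<open>v\<close> is \<open>s (pos v)\<close>, and \<open>dep v\<close> is the distance to it.\<close>

locale spined_tree = symmetric_graph +
  fixes s :: "nat \<Rightarrow> 'a" and q :: nat and pos dep :: "'a \<Rightarrow> nat"
  assumes q_pos: "0 < q"
    and pos_less: "v \<in> V \<Longrightarrow> pos v < q"
    and dep_le: "v \<in> V \<Longrightarrow> dep v \<le> 2"
    and s_V: "i < q \<Longrightarrow> s i \<in> V"
    and pos_s: "i < q \<Longrightarrow> pos (s i) = i"
    and dep_s: "i < q \<Longrightarrow> dep (s i) = 0"
    and spine_eq: "v \<in> V \<Longrightarrow> dep v = 0 \<Longrightarrow> s (pos v) = v"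
    and adj_s_Suc: "Suc i < q \<Longrightarrow> adj (s i) (s (Suc i))"
    and adj_cases: "adj u v \<Longrightarrow>
      dep u = 0 \<and> dep v = 0 \<and> (pos v = Suc (pos u) \<or> pos u = Suc (pos v)) \<or>
      pos u = pos v \<and> (dep v = Suc (dep u) \<or> dep u = Suc (dep v))"
    and adj_dep1: "v \<in> V \<Longrightarrow> dep v = 1 \<Longrightarrow> adj v (s (pos v))"
    and adj_dep2: "v \<in> V \<Longrightarrow> dep v = 2 \<Longrightarrow> \<exists>!x. adj v x"
    and pos_dep2: "v \<in> V \<Longrightarrow> dep v = 2 \<Longrightarrow> 0 < pos v \<and> Suc (pos v) < q"
    and end_legs: "\<exists>v. adj (s 0) v \<and> dep v = 1" "\<exists>v. adj (s (q - 1)) v \<and> dep v = 1"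
begin

lemma even_dep: "v \<in> V \<Longrightarrow> even (dep v) \<Longrightarrow> dep v = 0 \<or> dep v = 2"
  using dep_le[of v] by (auto simp: le_Suc_eq numeral_2_eq_2)

lemma adj_parity: "adj u v \<Longrightarrow> even (pos v + dep v) \<longleftrightarrow> odd (pos u + dep u)"
  by (drule adj_cases) (elim disjE conjE; simp)

text \<open>When the cat looks at \<open>s i\<close>, the mice that the sweep follows have even
  depth at position \<open>i\<close>. A depth-1 vertex that is a leaf therefore shelters none of
  them at that moment; only depth-2 vertices do, and they are entered and left through a
  leg.\<close>

definition legs :: "nat \<Rightarrow> 'a set" where
  "legs i = {x \<in> V. dep x = 1 \<and> pos x = i \<and> (\<exists>y. adj x y \<and> dep y = 2)}"

lemma finite_legs: "finite (legs i)"
  unfolding legs_def using finite_V by auto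

text \<open>Returning to \<open>s i\<close> after each leg means that legs are looked at an odd
  number of steps after \<open>s i\<close>, exactly when the followed mice at this position have odd
  depth. The order of the legs is immaterial.\<close>

definition sweep_at :: "nat \<Rightarrow> 'a list" where
  "sweep_at i = s i # concat (map (\<lambda>x. [x, s i]) (SOME xs. set xs = legs i \<and> distinct xs))"

definition sweep :: "'a list" where
  "sweep = concat (map sweep_at [0..<q])"

lemma legs_list: 
  obtains xs where "set xs = legs i" "distinct xs"
    "sweep_at i = s i # concat (map (\<lambda>x. [x, s i]) xs)"
proof -
  have "\<exists>xs. set xs = legs i \<and> distinct xs" using finite_legs finite_distinct_list by blast
  from someI_ex[OF this] show ?thesis by (intro that) (auto simp: sweep_at_def)
qed

lemma sweep_V: "set sweep \<subseteq> V"
proof -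
  have "set (sweep_at i) \<subseteq> V" if "i < q" for i
  proof -
    obtain xs where "set xs = legs i" "sweep_at i = s i # concat (map (\<lambda>x. [x, s i]) xs)"
      by (rule legs_list)
    then show ?thesis using s_V[OF that] by (auto simp: legs_def)
  qed
  moreover have "set sweep = (\<Union>i\<in>{..<q}. set (sweep_at i))" by (auto simp: sweep_def)
  ultimately show ?thesis by blast
qed

lemma length_sweep: "length sweep = q + 2 * (\<Sum>i<q. card (legs i))"
proof -
  have "length (sweep_at i) = 1 + 2 * card (legs i)" for i
  proof -
    obtain xs where xs: "set xs = legs i" "distinct xs"
      "sweep_at i = s i # concat (map (\<lambda>x. [x, s i]) xs)" by (rule legs_list)
    have "length (concat (map (\<lambda>x. [x, s i]) xs)) = 2 * length xs" by (induction xs) auto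
    then show ?thesis using xs distinct_card by fastforce
  qed
  then show ?thesis
    by (simp add: sweep_def length_concat comp_def interv_sum_list_conv_sum_set_nat
        sum_Suc sum_distrib_left atLeast0LessThan)
qed

text \<open>Where a mouse of the parity followed by the sweep can still be just after the cat has
  looked at \<open>s i\<close>, when only the legs in \<open>X\<close> remain to be searched there.\<close>

definition dirty :: "nat \<Rightarrow> 'a set \<Rightarrow> 'a set" where
  "dirty i X = {v \<in> V. even (pos v + dep v + i) \<and>
     (i < pos v \<or> pos v = i \<and> dep v = 2 \<and> (\<exists>x\<in>X. adj x v))}"

text \<open>Two moves during the looks at \<open>x\<close> and \<open>s i\<close>. By parity a mouse
  beyond position \<open>i\<close> is not on \<open>s (Suc i)\<close>, so it can get back to
  position \<open>i\<close> only on \<open>s i\<close>, under the second look. A mouse at depth 2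
  must leave through its own leg; this is not \<open>x\<close>, and from there it either enters
  \<open>s i\<close> and is seen or stays behind the same leg.\<close>

lemma dirty_step:
  assumes "i < q" "x \<in> X" "X \<subseteq> legs i" "v \<in> dirty i X" "adj v u" "u \<noteq> x" "adj u w" "w \<noteq> s i"
  shows "w \<in> dirty i (X - {x})"
proof -
  have V: "u \<in> V" "v \<in> V" "w \<in> V" using assms adj_V adj_V2 by blast+
  have w: "even (pos w + dep w + i)"
    using assms(4) adj_parity[OF \<open>adj v u\<close>] adj_parity[OF \<open>adj u w\<close>] by (simp add: dirty_def)
  have ws: "pos w = i \<Longrightarrow> dep w = 0 \<Longrightarrow> False" using spine_eq V assms by metis
  consider "i < pos v" | "pos v = i" "dep v = 2" "\<exists>x\<in>X. adj x v"
    using assms(4) by (auto simp: dirty_def)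
  then show ?thesis
  proof cases
    case 1
    then have "even (pos v + dep v + i)" using assms(4) by (auto simp: dirty_def)
    then have "dep v = 0 \<Longrightarrow> pos v \<noteq> Suc i" by auto
    with 1 have "i < pos u" using adj_cases[OF \<open>adj v u\<close>] by linarith
    then have "i \<le> pos w" using adj_cases[OF \<open>adj u w\<close>] by auto
    moreover have "i = pos w \<Longrightarrow> dep w = 0" using adj_cases[OF \<open>adj u w\<close>] \<open>i < pos u\<close> by auto
    ultimately have "i < pos w" using ws by (auto simp: order_le_less)
    then show ?thesis using w V by (auto simp: dirty_def)
  next
    case 2
    then obtain x' where x': "x' \<in> X" "adj x' v" by blast
    then have "u = x'" using adj_dep2[OF V(2) 2(2)] adj_sym \<open>adj v u\<close> by blast
    then have u: "u \<in> X - {x}" "dep u = 1" "pos u = i" using x' assms by (auto simp: legs_def)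
    then have "pos w = i" "dep w = 0 \<or> dep w = 2" using adj_cases[OF \<open>adj u w\<close>] by auto
    then show ?thesis using ws w V u \<open>adj u w\<close> by (auto simp: dirty_def)
  qed
qed

text \<open>The bound consists of the neighbours of \<open>dirty i {}\<close> because
  \<open>territory\<close> includes the move after the last look.\<close>

lemma territory_sweep_legs:
  assumes "i < q" "set xs \<subseteq> legs i" "S - {s i} \<subseteq> dirty i (set xs)"
  shows "territory adj S (s i # concat (map (\<lambda>x. [x, s i]) xs)) \<subseteq> {w. \<exists>v\<in>dirty i {}. adj v w}"
  using assms
proof (induction xs arbitrary: S)
  case Nil
  then show ?case by auto
next
  case (Cons x xs)
  let ?S1 = "{w. \<exists>v\<in>S - {s i}. adj v w}"
  let ?S2 = "{w. \<exists>v\<in>?S1 - {x}. adj v w}"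
  have "?S2 - {s i} \<subseteq> dirty i (set xs)"
  proof
    fix w assume "w \<in> ?S2 - {s i}"
    then obtain u v where uv: "v \<in> dirty i (set (x # xs))" "adj v u" "u \<noteq> x" "adj u w" "w \<noteq> s i"
      using Cons.prems(3) by blast
    from dirty_step[OF Cons.prems(1) _ Cons.prems(2) this]
    have "w \<in> dirty i (set (x # xs) - {x})" by simp
    then show "w \<in> dirty i (set xs)" by (auto simp: dirty_def)
  qed
  then show ?case using Cons.IH[of ?S2] Cons.prems by simp
qed

text \<open>The parity in \<open>dirty\<close> excludes \<open>s (Suc i)\<close> at the time of the
  look at \<open>s i\<close>, so the next move cannot lead back to position \<open>i\<close>. At the
  new position only depth-2 vertices stay possible, and all of its legs are still to be
  searched.\<close>

lemma dirty_next:
  assumes "Suc i < q" "v \<in> dirty i {}" "adj v w" "w \<noteq> s (Suc i)"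
  shows "w \<in> dirty (Suc i) (legs (Suc i))"
proof -
  have V: "v \<in> V" "w \<in> V" using assms adj_V adj_V2 by blast+
  have v: "even (pos v + dep v + i)" "i < pos v" using assms by (auto simp: dirty_def)
  have w: "even (pos w + dep w + Suc i)"
    using v adj_parity[OF \<open>adj v w\<close>] by simp
  have "dep v = 0 \<Longrightarrow> pos v \<noteq> Suc i" using v by auto
  with v have "i < pos w" using adj_cases[OF \<open>adj v w\<close>] by linarith
  moreover have "dep w = 2 \<and> (\<exists>x\<in>legs (Suc i). adj x w)" if p: "pos w = Suc i"
  proof -
    have "dep w \<noteq> 0" using spine_eq[OF V(2)] p assms(4) by auto
    moreover have "even (dep w)" using w p by (cases "even i") simp_all
    ultimately have w2: "dep w = 2" using even_dep[OF V(2)] by simp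
    then have "dep v = 1" "pos v = Suc i" using adj_cases[OF \<open>adj v w\<close>] dep_le[OF V(1)] p by auto
    then show ?thesis using w2 V \<open>adj v w\<close> by (auto simp: legs_def)
  qed
  ultimately show ?thesis using w V by (auto simp: dirty_def)
qed

text \<open>The invariant starts for free: by \<open>pos_dep2\<close> no depth-2 vertex sits at
  position 0, so the first look at \<open>s 0\<close> leaves nothing there. After the last spine
  vertex it says that the mouse is beyond the last position, which is impossible.\<close>

lemma territory_sweep:
  assumes "S \<subseteq> {v \<in> V. even (pos v + dep v)}"
  shows "territory adj S sweep = {}"
proof -
  have *: "territory adj S (concat (map sweep_at [0..<Suc j])) \<subseteq> {w. \<exists>v\<in>dirty j {}. adj v w}"
    if "j < q" for j using that
  proof (induction j)
    case 0
    obtain xs where xs: "set xs = legs 0" "distinct xs"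
      "sweep_at 0 = s 0 # concat (map (\<lambda>x. [x, s 0]) xs)" by (rule legs_list)
    have "S - {s 0} \<subseteq> dirty 0 (set xs)"
    proof
      fix v assume v: "v \<in> S - {s 0}"
      then have vV: "v \<in> V" "even (pos v + dep v)" using assms by auto
      have "pos v \<noteq> 0"
      proof
        assume p: "pos v = 0"
        then have "dep v \<noteq> 0" using spine_eq[OF vV(1)] v by auto
        moreover have "dep v \<noteq> 2" using pos_dep2[OF vV(1)] p by auto
        ultimately show False using even_dep[OF vV(1)] vV(2) p by simp
      qed
      then show "v \<in> dirty 0 (set xs)" using vV by (auto simp: dirty_def)
    qed
    then show ?case using territory_sweep_legs[of 0 xs S] xs 0 by auto
  next
    case (Suc j)
    let ?S = "territory adj S (concat (map sweep_at [0..<Suc j]))"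
    obtain xs where xs: "set xs = legs (Suc j)" "distinct xs"
      "sweep_at (Suc j) = s (Suc j) # concat (map (\<lambda>x. [x, s (Suc j)]) xs)" by (rule legs_list)
    have "?S - {s (Suc j)} \<subseteq> dirty (Suc j) (set xs)"
      using Suc.IH Suc.prems dirty_next[OF Suc.prems] xs by auto
    from territory_sweep_legs[OF Suc.prems _ this]
    show ?case using xs by (simp add: territory_append)
  qed
  obtain j where j: "q = Suc j" using q_pos by (cases q) auto
  have "dirty j {} = {}" using pos_less j by (fastforce simp: dirty_def)
  moreover have "sweep = concat (map sweep_at [0..<Suc j])"
    unfolding sweep_def by (simp only: j[symmetric])
  ultimately show ?thesis using *[of j] j by fastforce
qed

section \<open>The mice of the other parity and the reversed sweep\<close>

lemma parity_territory:
  assumes "S \<subseteq> {v \<in> V. odd (pos v + dep v)}"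
  shows "territory adj S cs \<subseteq> {v \<in> V. odd (pos v + dep v + length cs)}"
  using assms
proof (induction cs rule: rev_induct)
  case (snoc c cs)
  then have IH: "territory adj S cs \<subseteq> {v \<in> V. odd (pos v + dep v + length cs)}" by simp
  show ?case
  proof
    fix w assume "w \<in> territory adj S (cs @ [c])"
    then obtain v where v: "v \<in> territory adj S cs" "adj v w" by (auto simp: territory_append)
    then have "odd (pos v + dep v + length cs)" using IH by auto
    then show "w \<in> {v \<in> V. odd (pos v + dep v + length (cs @ [c]))}"
      using adj_parity[OF v(2)] adj_V2[OF v(2)] by simp
  qed
qed simp

lemma reverse: "spined_tree V adj (\<lambda>i. s (q - Suc i)) q (\<lambda>v. q - Suc (pos v)) dep"
proof unfold_locales
  fix u v assume uv: "adj u v"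
  have "pos u < q" "pos v < q" using pos_less adj_V[OF uv] adj_V2[OF uv] by auto
  then show "dep u = 0 \<and> dep v = 0 \<and>
      (q - Suc (pos v) = Suc (q - Suc (pos u)) \<or> q - Suc (pos u) = Suc (q - Suc (pos v))) \<or>
      q - Suc (pos u) = q - Suc (pos v) \<and> (dep v = Suc (dep u) \<or> dep u = Suc (dep v))"
    using adj_cases[OF uv] by auto
next
  fix i assume i: "Suc i < q"
  then have "adj (s (q - Suc (Suc i))) (s (Suc (q - Suc (Suc i))))" by (intro adj_s_Suc) auto
  then show "adj (s (q - Suc i)) (s (q - Suc (Suc i)))" using i adj_sym by (simp add: Suc_diff_Suc)
next
  fix v assume v: "v \<in> V" "dep v = 0"
  have "q - Suc (q - Suc (pos v)) = pos v" using pos_less[OF v(1)] by arith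
  then show "s (q - Suc (q - Suc (pos v))) = v" using spine_eq v by simp
next
  fix v assume v: "v \<in> V" "dep v = 1"
  have "q - Suc (q - Suc (pos v)) = pos v" using pos_less[OF v(1)] by arith
  then show "adj v (s (q - Suc (q - Suc (pos v))))" using adj_dep1 v by simp
next
  fix v assume v: "v \<in> V" "dep v = 2"
  then show "\<exists>!x. adj v x" "0 < q - Suc (pos v) \<and> Suc (q - Suc (pos v)) < q"
    using adj_dep2 pos_dep2[OF v] by auto
next
  show "\<exists>v. adj (s (q - Suc 0)) v \<and> dep v = 1" "\<exists>v. adj (s (q - Suc (q - 1))) v \<and> dep v = 1"
    using end_legs q_pos by auto
qed (use q_pos pos_less dep_le s_V pos_s dep_s in auto)

text \<open>The length of a sweep is congruent to \<open>q\<close> modulo 2, so the surviving mice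
  have \<open>pos v + dep v + q\<close> odd. The reversed position is \<open>q - 1 - pos v\<close>,
  hence reversed position plus depth is even for them. This is the parity caught by the reversed
  sweep, whether \<open>q\<close> is even or odd.\<close>

lemma double_sweep:
  obtains cs where "set cs \<subseteq> V" "length cs = 2 * (q + 2 * (\<Sum>i<q. card (legs i)))"
    "territory adj V cs = {}"
proof -
  interpret R: spined_tree V adj "\<lambda>i. s (q - Suc i)" q "\<lambda>v. q - Suc (pos v)" dep by (rule reverse)
  let ?A = "{v \<in> V. even (pos v + dep v)}" and ?B = "{v \<in> V. odd (pos v + dep v)}"
  have "territory adj V sweep = territory adj (?A \<union> ?B) sweep"
    by (rule arg_cong[of _ _ "\<lambda>S. territory adj S sweep"]) auto
  also have "\<dots> = territory adj ?A sweep \<union> territory adj ?B sweep" by (rule territory_Un)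
  also have "\<dots> \<subseteq> {v \<in> V. odd (pos v + dep v + q)}"
    using territory_sweep[of ?A] parity_territory[of ?B sweep] by (auto simp: length_sweep)
  also have "\<dots> \<subseteq> {v \<in> V. even (q - Suc (pos v) + dep v)}"
  proof
    fix v assume v: "v \<in> {v \<in> V. odd (pos v + dep v + q)}"
    then obtain k where k: "q = Suc (pos v + k)" using pos_less[of v] less_iff_Suc_add by auto
    show "v \<in> {v \<in> V. even (q - Suc (pos v) + dep v)}" using v unfolding k by auto
  qed
  finally have "territory adj (territory adj V sweep) R.sweep = {}"
    by (rule R.territory_sweep)
  moreover have "(\<Sum>i<q. card (R.legs i)) = (\<Sum>i<q. card (legs i))"
  proof -
    have "R.legs i = legs (q - Suc i)" if "i < q" for i
      using pos_less that by (force simp: R.legs_def legs_def)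
    then have "(\<Sum>i<q. card (R.legs i)) = (\<Sum>i<q. card (legs (q - Suc i)))" by simp
    also have "\<dots> = (\<Sum>i<q. card (legs i))" by (rule sum.nat_diff_reindex)
    finally show ?thesis .
  qed
  ultimately show ?thesis
    using sweep_V R.sweep_V
    by (intro that[of "sweep @ R.sweep"]) (auto simp: territory_append length_sweep R.length_sweep)
qed

end

section \<open>Counting leaves, twigs and visits\<close>

lemma two_le_card: "finite A \<Longrightarrow> a \<in> A \<Longrightarrow> b \<in> A \<Longrightarrow> a \<noteq> b \<Longrightarrow> 2 \<le> card A"
  using card_mono[of A "{a, b}"] by auto

context symmetric_graph
begin

definition leaf_set :: "'a set" where
  "leaf_set = {v \<in> V. card {w. adj v w} = 1}"

definition twig_set :: "'a set" where
  "twig_set = {v \<in> V. 2 \<le> card {w. adj v w} \<and>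
     card {w. adj v w} - 1 \<le> card {w \<in> leaf_set. adj v w}}"

lemma twigI:
  assumes "2 \<le> card {w. adj v w}" "\<And>w. adj v w \<Longrightarrow> w \<noteq> u \<Longrightarrow> w \<in> leaf_set"
  shows "v \<in> twig_set"
proof -
  have "v \<in> V" using assms(1) by (metis adj_V card.empty empty_Collect_eq not_numeral_le_zero)
  moreover have "card {w. adj v w} - 1 \<le> card ({w. adj v w} - {u})"
    by (simp add: card_Diff_singleton_if)
  moreover have "card ({w. adj v w} - {u}) \<le> card {w \<in> leaf_set. adj v w}"
    using assms(2) by (intro card_mono finite_subset[OF _ finite_nbhd[of v]]) auto
  ultimately show ?thesis using assms(1) unfolding twig_set_def by auto
qed

lemma not_twigI:
  assumes "adj v u" "adj v u'" "u \<noteq> u'" "u \<notin> leaf_set" "u' \<notin> leaf_set"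
  shows "v \<notin> twig_set"
proof -
  have "card {w \<in> leaf_set. adj v w} \<le> card ({w. adj v w} - {u, u'})"
    using assms by (intro card_mono) (auto simp: finite_nbhd)
  also have "\<dots> = card {w. adj v w} - 2"
    using assms by (subst card_Diff_subset) auto
  finally show ?thesis unfolding twig_set_def by auto
qed

end

context spined_tree
begin

definition all_legs :: "'a set" where
  "all_legs = (\<Union>i<q. legs i)"

lemma all_legs_eq: "all_legs = {x \<in> V. dep x = 1 \<and> (\<exists>y. adj x y \<and> dep y = 2)}"
  using pos_less by (auto simp: all_legs_def legs_def)

lemma card_all_legs: "card all_legs = (\<Sum>i<q. card (legs i))"
  unfolding all_legs_def using finite_legs by (intro card_UN_disjoint) (auto simp: legs_def)

lemma spine_inj: "inj_on s {..<q}"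
  by (rule inj_on_inverseI[of _ pos]) (simp add: pos_s)

lemma dep1_nbr:
  assumes "dep v = 1" "adj v w"
  shows "w = s (pos v) \<or> dep w = 2"
  using adj_cases[OF assms(2)] assms(1) spine_eq[OF adj_V2[OF assms(2)]] by auto

lemma dep2_leaf: "v \<in> V \<Longrightarrow> dep v = 2 \<Longrightarrow> v \<in> leaf_set"
proof -
  assume v: "v \<in> V" "dep v = 2"
  from adj_dep2[OF this] obtain x where "{w. adj v w} = {x}" by auto
  then show ?thesis using v by (simp add: leaf_set_def)
qed

lemma dep1_leaf:
  assumes "v \<in> V" "dep v = 1" "v \<notin> all_legs"
  shows "v \<in> leaf_set"
proof -
  have "{w. adj v w} = {s (pos v)}"
    using assms dep1_nbr adj_dep1 by (auto simp: all_legs_eq)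
  then show ?thesis using assms by (simp add: leaf_set_def)
qed

lemma leg_degree: "v \<in> all_legs \<Longrightarrow> 2 \<le> card {w. adj v w}"
proof -
  assume "v \<in> all_legs"
  then obtain y where v: "v \<in> V" "dep v = 1" "adj v y" "dep y = 2" by (auto simp: all_legs_eq)
  moreover have "dep (s (pos v)) = 0" using dep_s pos_less v by blast
  then have "s (pos v) \<noteq> y" using v by auto
  ultimately show ?thesis using two_le_card[OF finite_nbhd] adj_dep1[of v] by blast
qed

lemma end_pos:
  assumes "x \<in> all_legs" shows "0 < pos x \<and> Suc (pos x) < q"
proof -
  obtain y where y: "dep x = 1" "adj x y" "dep y = 2" using assms by (auto simp: all_legs_eq)
  then have "pos y = pos x" using adj_cases[OF y(2)] by auto
  then show ?thesis using pos_dep2[of y] y adj_V2 by auto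
qed

lemma legs_ends: "legs 0 = {}" "Suc i = q \<Longrightarrow> legs i = {}"
proof -
  have "legs j \<subseteq> {x \<in> all_legs. pos x = j}" for j by (auto simp: legs_def all_legs_eq)
  then show "legs 0 = {}" "Suc i = q \<Longrightarrow> legs i = {}" using end_pos by fastforce+
qed

lemma spine_not_dep1: "i < q \<Longrightarrow> dep v = 1 \<Longrightarrow> s i \<noteq> v"
  using dep_s by fastforce

lemma adj_s_pred: "0 < i \<Longrightarrow> i < q \<Longrightarrow> adj (s i) (s (i - 1))"
  using adj_s_Suc[of "i - 1"] adj_sym by simp

lemma s_neq: "i < q \<Longrightarrow> j < q \<Longrightarrow> i \<noteq> j \<Longrightarrow> s i \<noteq> s j"
  using spine_inj by (auto simp: inj_on_def)

lemma spine_degree: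
  assumes "2 \<le> q" "i < q"
  shows "2 \<le> card {w. adj (s i) w}"
proof -
  consider "i = 0" | "Suc i = q" | "0 < i" "Suc i < q" using assms by linarith
  then show ?thesis
  proof cases
    case 1
    obtain v where "adj (s 0) v" "dep v = 1" using end_legs by blast
    moreover have "adj (s 0) (s 1)" using adj_s_Suc[of 0] assms by simp
    moreover have "s 1 \<noteq> v" using spine_not_dep1 assms \<open>dep v = 1\<close> by simp
    ultimately show ?thesis using two_le_card[OF finite_nbhd] 1 by blast
  next
    case 2
    obtain v where v: "adj (s i) v" "dep v = 1" using end_legs 2 by auto
    moreover have "adj (s i) (s (i - 1))" using adj_s_pred assms 2 by simp
    moreover have "s (i - 1) \<noteq> v" using spine_not_dep1 assms v by simp
    ultimately show ?thesis using two_le_card[OF finite_nbhd] by blast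
  next
    case 3
    then have "adj (s i) (s (i - 1))" "adj (s i) (s (Suc i))" "s (i - 1) \<noteq> s (Suc i)"
      using adj_s_pred adj_s_Suc s_neq by auto
    then show ?thesis using two_le_card[OF finite_nbhd] by blast
  qed
qed

lemma non_leaves:
  assumes "2 \<le> q"
  shows "V - leaf_set = s ` {..<q} \<union> all_legs"
proof -
  have "s i \<notin> leaf_set" if "i < q" for i using spine_degree[OF assms that] by (simp add: leaf_set_def)
  moreover have "v \<notin> leaf_set" if "v \<in> all_legs" for v
    using leg_degree[OF that] by (simp add: leaf_set_def)
  moreover have "v \<in> s ` {..<q}" if v: "v \<in> V - leaf_set" "v \<notin> all_legs" for v
  proof -
    have "dep v \<noteq> 2" "dep v \<noteq> 1" using dep2_leaf dep1_leaf v by auto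
    then have "dep v = 0" using dep_le[of v] v by auto
    then show ?thesis using spine_eq[of v] pos_less[of v] v by (metis DiffD1 imageI lessThan_iff)
  qed
  moreover have "s ` {..<q} \<subseteq> V" "all_legs \<subseteq> V" using s_V by (auto simp: all_legs_eq)
  ultimately show ?thesis by blast
qed

text \<open>A twig has at most one non-leaf neighbour. For a leg this is its spine vertex; for an
  end of the spine it is the next spine vertex, because no leg sits at the ends. An inner spine
  vertex has two non-leaf neighbours on the spine already.\<close>

lemma twigs_eq:
  assumes "2 \<le> q"
  shows "twig_set = {s 0, s (q - 1)} \<union> all_legs"
proof -
  have leg: "x \<in> twig_set" if "x \<in> all_legs" for x
  proof (rule twigI[OF leg_degree[OF that], of "s (pos x)"])
    fix w assume "adj x w" "w \<noteq> s (pos x)"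
    then have "dep w = 2" using dep1_nbr[of x w] that by (auto simp: all_legs_eq)
    then show "w \<in> leaf_set" using dep2_leaf adj_V2[OF \<open>adj x w\<close>] by simp
  qed
  have dep1_nbr_end: "w \<in> leaf_set" if "adj (s i) w" "dep w \<noteq> 0" "i = 0 \<or> Suc i = q" for i w
  proof -
    have i: "i < q" using that assms by auto
    have "pos w = i" "dep w = 1" using adj_cases[OF that(1)] that dep_s[OF i] pos_s[OF i] by auto
    then show ?thesis using dep1_leaf end_pos adj_V2 that by fastforce
  qed
  have ends: "s i \<in> twig_set"
    if "i = 0 \<and> j = 1 \<or> Suc i = q \<and> j = i - 1" for i j
  proof (rule twigI[OF spine_degree[OF assms], of _ "s j"])
    show i: "i < q" using that assms by auto
    fix w assume w: "adj (s i) w" "w \<noteq> s j"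
    have "dep w \<noteq> 0"
    proof
      assume d: "dep w = 0"
      then have "pos w = Suc i \<or> i = Suc (pos w)"
        using adj_cases[OF w(1)] dep_s[OF i] pos_s[OF i] by auto
      then have "pos w = j" using that pos_less[OF adj_V2[OF w(1)]] by auto
      then show False using w spine_eq[OF adj_V2[OF w(1)] d] by auto
    qed
    then show "w \<in> leaf_set" using dep1_nbr_end w that by auto
  qed
  have inner: "s i \<notin> twig_set" if "0 < i" "Suc i < q" for i
  proof (rule not_twigI)
    show "adj (s i) (s (i - 1))" "adj (s i) (s (Suc i))" "s (i - 1) \<noteq> s (Suc i)"
      using that adj_s_pred adj_s_Suc s_neq by auto
    show "s (i - 1) \<notin> leaf_set" "s (Suc i) \<notin> leaf_set" using that non_leaves[OF assms] by auto
  qed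
  show ?thesis
  proof
    show "{s 0, s (q - 1)} \<union> all_legs \<subseteq> twig_set" 
      using leg ends[of 0 1] ends[of "q - 1" "q - 1 - 1"] assms by auto
    show "twig_set \<subseteq> {s 0, s (q - 1)} \<union> all_legs"
    proof
      fix v assume v: "v \<in> twig_set"
      then have "v \<in> V - leaf_set" by (auto simp: twig_set_def leaf_set_def)
      then consider i where "v = s i" "i < q" | "v \<in> all_legs" using non_leaves[OF assms] by blast
      then show "v \<in> {s 0, s (q - 1)} \<union> all_legs"
      proof cases
        case 1
        then have "i = 0 \<or> i = q - 1" using inner[of i] v by fastforce
        then show ?thesis using 1 by auto
      qed auto
    qed
  qed
qed

lemma card_non_leaves: "2 \<le> q \<Longrightarrow> card V = card leaf_set + q + card all_legs"
proof -
  assume q: "2 \<le> q"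
  have "card (s ` {..<q} \<union> all_legs) = card (s ` {..<q}) + card all_legs"
    using finite_V spine_not_dep1 by (intro card_Un_disjoint) (auto simp: all_legs_eq)
  moreover have "card (s ` {..<q}) = q" using card_image[OF spine_inj] by simp
  moreover have "leaf_set \<subseteq> V" by (auto simp: leaf_set_def)
  then have "card V = card leaf_set + card (V - leaf_set)"
    using finite_V by (metis card_Diff_subset card_mono finite_subset le_add_diff_inverse)
  ultimately show ?thesis using non_leaves[OF q] by simp
qed

lemma card_twigs: "2 \<le> q \<Longrightarrow> card twig_set = 2 + card all_legs"
proof -
  assume q: "2 \<le> q"
  have "card ({s 0, s (q - 1)} \<union> all_legs) = card {s 0, s (q - 1)} + card all_legs"
    using finite_V dep_s[of 0] dep_s[of "q - 1"] q
    by (intro card_Un_disjoint) (auto simp: all_legs_eq)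
  moreover have "s 0 \<noteq> s (q - 1)" using s_neq q by simp
  ultimately show ?thesis using twigs_eq[OF q] by simp
qed

text \<open>At a spine vertex with legs the set \<open>H\<close> contains both spine neighbours and
  all the legs, so \<open>visits_lower_bound\<close> forces \<open>card (legs i) + 1\<close> visits
  for each parity; elsewhere its bound 1 is used. The sum of these values \<open>f\<close> is
  precisely the length of one sweep.\<close>

lemma length_ge:
  assumes q: "2 \<le> q" and cs: "set cs \<subseteq> V" "territory adj V cs = {}"
  shows "2 * (q + 2 * card all_legs) \<le> length cs"
proof -
  define f where "f v = (if dep v = 0 then 1 + card (legs (pos v)) else 1)" for v
  let ?U = "s ` {..<q} \<union> all_legs"
  have deg: "2 \<le> card {w. adj v w}" if "v \<in> ?U" for v
    using that spine_degree[OF q] leg_degree by auto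
  have "f v \<le> visits b v cs" if "v \<in> ?U" for v b
  proof (cases "dep v = 0 \<and> legs (pos v) \<noteq> {}")
    case False
    then show ?thesis using visits_lower_bound[OF deg[OF that] cs(2), of b] by (auto simp: f_def)
  next
    case True
    then have "v \<in> s ` {..<q}" using that by (auto simp: all_legs_eq)
    then obtain i where i: "v = s i" "i < q" "pos v = i" using pos_s by auto
    with True legs_ends have mid: "0 < i" "Suc i < q" by (cases "i = 0"; fastforce)+
    let ?H = "{w. adj v w \<and> (\<exists>x. adj w x \<and> x \<noteq> v)}"
    have "{s (i - 1), s (Suc i)} \<union> legs i \<subseteq> ?H"
    proof -
      have "w \<in> ?H" if "adj v w" "w \<in> ?U" for w
      proof -
        have "\<not> {x. adj w x} \<subseteq> {v}"
          using deg[OF that(2)] card_mono[of "{v}" "{x. adj w x}"] by auto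
        then show ?thesis using that by auto
      qed
      moreover have "adj v (s (i - 1))" "adj v (s (Suc i))" "s (i - 1) \<in> ?U" "s (Suc i) \<in> ?U"
        using mid i adj_s_pred adj_s_Suc by auto
      moreover have "adj v w \<and> w \<in> ?U" if "w \<in> legs i" for w
        using that i adj_dep1[of w] adj_sym by (auto simp: legs_def all_legs_eq)
      ultimately show ?thesis by blast
    qed
    then have "card ({s (i - 1), s (Suc i)} \<union> legs i) \<le> card ?H"
      by (intro card_mono finite_subset[OF _ finite_nbhd[of v]]) auto
    moreover have "card ({s (i - 1), s (Suc i)} \<union> legs i) = card {s (i - 1), s (Suc i)} + card (legs i)"
      using mid dep_s[of "i - 1"] dep_s[of "Suc i"] finite_legs by (intro card_Un_disjoint) (auto simp: legs_def)
    moreover have "card {s (i - 1), s (Suc i)} = 2" using s_neq[of "i - 1" "Suc i"] mid by simp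
    ultimately show ?thesis
      using visits_lower_bound[OF deg[OF that] cs(2), of b] True i by (auto simp: f_def)
  qed
  then have "2 * sum f ?U \<le> length cs"
    using cs(1) s_V by (intro length_lower_bound) (auto simp: all_legs_eq)
  moreover have "sum f ?U = sum f (s ` {..<q}) + sum f all_legs"
    using finite_V spine_not_dep1 by (intro sum.union_disjoint) (auto simp: all_legs_eq)
  moreover have "sum f (s ` {..<q}) = (\<Sum>i<q. 1 + card (legs i))"
    unfolding sum.reindex[OF spine_inj] by (intro sum.cong) (auto simp: f_def dep_s pos_s)
  moreover have "sum f all_legs = card all_legs" by (simp add: f_def all_legs_eq)
  ultimately show ?thesis by (simp add: card_all_legs sum.distrib sum_Suc)
qed

lemma mouse_bounds:
  assumes "2 \<le> q"
  obtains k where "int k = 2 * int (card V) + 2 * int (card twig_set) - 2 * int (card leaf_set) - 4"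
    "2 \<le> k" "\<exists>cs. set cs \<subseteq> V \<and> length cs = k \<and> territory adj V cs = {}"
    "\<And>cs. set cs \<subseteq> V \<Longrightarrow> territory adj V cs = {} \<Longrightarrow> k \<le> length cs"
proof
  let ?k = "2 * (q + 2 * card all_legs)"
  show "int ?k = 2 * int (card V) + 2 * int (card twig_set) - 2 * int (card leaf_set) - 4"
    using card_non_leaves[OF assms] card_twigs[OF assms] by simp
  show "2 \<le> ?k" using assms by simp
  show "\<exists>cs. set cs \<subseteq> V \<and> length cs = ?k \<and> territory adj V cs = {}"
    using double_sweep card_all_legs by metis
qed (rule length_ge[OF assms])

end

section \<open>The spine of a tree without three long arms\<close>

text \<open>Acyclicity is phrased for duplicate-free vertex lists. Connectedness has the form of an
  induction principle: a property that passes along edges and holds somewhere holds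
  everywhere.\<close>

locale tree_graph = symmetric_graph +
  assumes acyclic: "distinct xs \<Longrightarrow> successively adj xs \<Longrightarrow> 3 \<le> length xs \<Longrightarrow> \<not> adj (last xs) (hd xs)"
    and connected: "S \<subseteq> V \<Longrightarrow> S \<noteq> {} \<Longrightarrow> (\<And>u v. u \<in> S \<Longrightarrow> adj u v \<Longrightarrow> v \<in> S) \<Longrightarrow> S = V"
begin

definition path :: "'a list \<Rightarrow> bool" where
  "path xs \<longleftrightarrow> set xs \<subseteq> V \<and> distinct xs \<and> successively adj xs"

text \<open>In a tree these conditions force the ten vertices of \<open>T\<^sup>*\<close> to be distinct.\<close>

definition spider :: bool where
  "spider \<longleftrightarrow> (\<exists>z a b c. inj_on a {..<3::nat} \<and>
     (\<forall>i<3. adj z (a i) \<and> adj (a i) (b i) \<and> adj (b i) (c i) \<and> b i \<noteq> z \<and> c i \<noteq> a i))"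

lemma path_rev: "path xs \<Longrightarrow> path (rev xs)"
  unfolding path_def using adj_sym by (auto simp: successively_rev elim: successively_mono)

text \<open>In a tree it suffices that the new vertex does not turn back along the path.\<close>

lemma path_Cons:
  assumes ys: "path ys" "ys \<noteq> []" and adj: "adj x (hd ys)" and ne: "2 \<le> length ys \<Longrightarrow> x \<noteq> ys ! 1"
  shows "path (x # ys)"
proof -
  have "x \<notin> set ys"
  proof
    assume "x \<in> set ys"
    then obtain as bs where s: "ys = as @ x # bs" "x \<notin> set as" by (meson split_list_first)
    have "as \<noteq> []" using adj adj_irrefl s by auto
    moreover have "length as \<noteq> 1" using ne s by (auto simp: nth_append)
    ultimately have len: "3 \<le> length (x # as)" by (cases as rule: remdups_adj.cases) auto
    have suc: "successively adj as" "adj (last as) x"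
      using ys s \<open>as \<noteq> []\<close> by (auto simp: path_def successively_append_iff)
    have "successively adj (x # as)" using suc adj s \<open>as \<noteq> []\<close> by (auto simp: successively_Cons)
    moreover have "distinct (x # as)" using ys s by (auto simp: path_def)
    ultimately show False using acyclic[of "x # as"] len suc \<open>as \<noteq> []\<close> by auto
  qed
  then show ?thesis
    using assms adj_V by (auto simp: path_def successively_Cons)
qed

text \<open>Two arms joined at \<open>z\<close> are built up as one path with seven vertices,
  starting from the tip of arm \<open>j\<close>. By \<open>path_Cons\<close> each extension only has
  to avoid turning back, and that much is part of \<open>spider\<close>.\<close>

lemma spider_distinct:
  assumes a: "inj_on a {..<3::nat}"
    and adj: "\<And>i. i < 3 \<Longrightarrow> adj z (a i) \<and> adj (a i) (b i) \<and> adj (b i) (c i) \<and> b i \<noteq> z \<and> c i \<noteq> a i"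
    and ij: "i < 3" "j < 3" "i \<noteq> j"
  shows "distinct [c i, b i, a i, z, a j, b j, c j]"
proof -
  have "a i \<noteq> a j" using a ij by (auto simp: inj_on_def)
  have "path [c j]" using adj_V2 adj ij by (auto simp: path_def)
  then have "path [b j, c j]" by (rule path_Cons) (use adj ij in auto)
  then have "path [a j, b j, c j]" by (rule path_Cons) (use adj[OF ij(2)] in auto)
  then have "path [z, a j, b j, c j]" by (rule path_Cons) (use adj[OF ij(2)] in auto)
  then have "path [a i, z, a j, b j, c j]"
    by (rule path_Cons) (use adj[OF ij(1)] adj_sym \<open>a i \<noteq> a j\<close> in auto)
  then have "path [b i, a i, z, a j, b j, c j]"
    by (rule path_Cons) (use adj[OF ij(1)] adj_sym in auto)
  then have "path [c i, b i, a i, z, a j, b j, c j]"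
    by (rule path_Cons) (use adj[OF ij(1)] adj_sym in auto)
  then show ?thesis by (simp only: path_def)
qed

lemma longest_path:
  obtains p where "path p" "\<And>p'. path p' \<Longrightarrow> length p' \<le> length p"
proof -
  have "length p' < Suc (card V)" if "path p'" for p'
    using that finite_V by (metis card_mono distinct_card le_imp_less_Suc path_def)
  moreover have "path []" by (simp add: path_def)
  ultimately have "\<exists>p. path p \<and> (\<forall>p'. path p' \<longrightarrow> length p' \<le> length p)"
    using ex_has_greatest_nat[of path "[]" length "Suc (card V)"] by blast
  then show ?thesis using that by blast
qed

end

locale longest_path_tree = tree_graph +
  fixes p :: "'a list"
  assumes path_p: "path p"
    and longest: "path p' \<Longrightarrow> length p' \<le> length p"
    and three_vertices: "3 \<le> card V"
begin

text \<open>If a longest path had only one or two vertices, they would have no further neighbours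
  and, by connectedness, would be all of \<open>V\<close>.\<close>

lemma length_p: "3 \<le> length p"
proof (rule ccontr)
  assume "\<not> 3 \<le> length p"
  then consider "p = []" | a where "p = [a]" | a b where "p = [a, b]"
    by (cases p rule: remdups_adj.cases) (auto simp: Suc_le_eq numeral_3_eq_3)
  then show False
  proof cases
    case 1
    obtain v where "v \<in> V" using three_vertices by fastforce
    then show False using longest[of "[v]"] 1 by (simp add: path_def)
  next
    case 2
    have "b = a" if "adj a b" for b
      using longest[OF path_Cons[OF path_p, of b]] that 2 adj_sym by auto
    then have "{a} = V" using path_p 2 by (intro connected) (auto simp: path_def)
    then show False using three_vertices by auto
  next
    case 3
    have "c = b" if "adj a c" for c
      using longest[OF path_Cons[OF path_p, of c]] that 3 adj_sym by auto
    moreover have "c = a" if "adj b c" for c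
      using longest[OF path_Cons[OF path_rev[OF path_p], of c]] that 3 adj_sym by auto
    ultimately have "{a, b} = V" using path_p 3 by (intro connected) (auto simp: path_def)
    moreover have "card {a, b} \<le> 2" by (simp add: card_insert_if)
    ultimately show False using three_vertices by simp
  qed
qed

definition q :: nat where "q = length p - 2"

text \<open>The spine omits both end vertices of the longest path.\<close>

definition s :: "nat \<Rightarrow> 'a" where "s i = p ! Suc i"

definition spine :: "'a set" where "spine = s ` {..<q}"

lemma length_p_q: "length p = Suc (Suc q)"
  using length_p by (simp add: q_def)

lemma p_neq: "i < length p \<Longrightarrow> j < length p \<Longrightarrow> i \<noteq> j \<Longrightarrow> p ! i \<noteq> p ! j"
  using path_p by (auto simp: path_def nth_eq_iff_index_eq)

lemma p_adj: "Suc i < length p \<Longrightarrow> adj (p ! i) (p ! Suc i)"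
  using path_p by (auto simp: path_def successively_conv_nth)

lemma s_inj: "inj_on s {..<q}"
  by (rule inj_onI, rule ccontr) (use p_neq length_p_q in \<open>auto simp: s_def\<close>)

lemma spine_segment:
  assumes "i \<le> j" "j < q"
  shows "distinct (map s [i..<Suc j])" "successively adj (map s [i..<Suc j])"
    "set (map s [i..<Suc j]) \<subseteq> spine" "hd (map s [i..<Suc j]) = s i" "last (map s [i..<Suc j]) = s j"
proof -
  show "distinct (map s [i..<Suc j])"
    using assms by (auto simp: distinct_map simp del: upt_Suc intro: inj_on_subset[OF s_inj])
  show "successively adj (map s [i..<Suc j])"
    using assms p_adj by (auto simp: successively_conv_nth s_def length_p_q simp del: upt_Suc)
  show "set (map s [i..<Suc j]) \<subseteq> spine" using assms by (auto simp: spine_def simp del: upt_Suc)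
  show "hd (map s [i..<Suc j]) = s i" using assms by (simp add: hd_map del: upt_Suc)
  show "last (map s [i..<Suc j]) = s j" using assms by simp
qed

lemma spine_adj:
  assumes "i < q" "j < q" "adj (s i) (s j)"
  shows "j = Suc i \<or> i = Suc j"
proof -
  have "\<not> adj (s i) (s j)" if ij: "Suc i < j" "j < q" for i j
  proof -
    have "\<not> adj (last (map s [i..<Suc j])) (hd (map s [i..<Suc j]))"
      using ij spine_segment[of i j] by (intro acyclic) auto
    then show ?thesis using spine_segment[of i j] ij adj_sym by auto
  qed
  moreover have "i \<noteq> j" using assms adj_irrefl by metis
  ultimately show ?thesis using assms adj_sym by (metis linorder_neqE_nat not_less_eq Suc_lessI)
qed

text \<open>Otherwise \<open>x\<close> would close a cycle with the spine segment between the two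
  neighbours.\<close>

lemma spine_nbr_unique:
  assumes "x \<notin> spine" "i < q" "j < q" "adj x (s i)" "adj x (s j)"
  shows "i = j"
proof -
  have False if ij: "i < j" "j < q" "adj x (s i)" "adj x (s j)" for i j
  proof -
    let ?L = "map s [i..<Suc j]"
    have L: "distinct ?L" "successively adj ?L" "set ?L \<subseteq> spine" "hd ?L = s i" "last ?L = s j"
      using spine_segment[of i j] ij by simp_all
    have ne: "?L \<noteq> []" using ij by simp
    have "\<not> adj (last (x # ?L)) (hd (x # ?L))"
    proof (rule acyclic)
      show "distinct (x # ?L)" using L(1,3) assms(1) by auto
      show "successively adj (x # ?L)" using L(2,4) ne ij by (simp only: successively_Cons) simp
      show "3 \<le> length (x # ?L)" using ij by simp
    qed
    then show False using L(5) ne ij adj_sym by simp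
  qed
  then show ?thesis using assms by (metis linorder_neqE_nat)
qed

text \<open>The branch through \<open>x\<close> and \<open>y\<close> is to replace the first
  \<open>k\<close> vertices of \<open>p\<close>. Since \<open>x\<close> is off the spine, it could
  be the successor of \<open>p ! k\<close> only as the last vertex of \<open>p\<close>, and then
  \<open>y\<close> would prolong \<open>p\<close>.\<close>

lemma off_spine_step:
  assumes k: "Suc k < length p" "0 < k" and x: "x \<notin> spine" "adj x (p ! k)"
    and y: "adj y x" "y \<noteq> p ! k"
  shows "x \<noteq> p ! Suc k" and "path (y # x # drop k p)"
proof -
  show ne: "x \<noteq> p ! Suc k"
  proof
    assume e: "x = p ! Suc k"
    then have "\<not> k < q" using x(1) by (auto simp: spine_def s_def)
    then have kq: "k = q" using k length_p_q by simp
    have "path (y # rev p)"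
    proof (rule path_Cons[OF path_rev[OF path_p]])
      show "rev p \<noteq> []" using length_p by auto
      show "adj y (hd (rev p))"
        using y e kq length_p_q by (simp add: hd_rev last_conv_nth length_p_q flip: length_0_conv)
      show "y \<noteq> rev p ! 1" using y kq length_p_q by (simp add: rev_nth)
    qed
    then show False using longest by fastforce
  qed
  have d: "path (drop k p)"
    using path_p by (auto simp: path_def dest: in_set_dropD)
      (metis append_take_drop_id successively_append_iff)
  have "path (x # drop k p)"
    by (rule path_Cons[OF d]) (use k x ne in \<open>auto simp: hd_drop_conv_nth\<close>)
  then show "path (y # x # drop k p)"
    by (rule path_Cons) (use k y in auto)
qed

text \<open>Two or three branch vertices now stand in place of \<open>k\<close> vertices of
  \<open>p\<close>, so maximality of \<open>p\<close> bounds \<open>k\<close> from below.\<close>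

lemma off_spine_step_length:
  assumes k: "Suc k < length p" "0 < k" and x: "x \<notin> spine" "adj x (p ! k)"
    and y: "adj y x" "y \<noteq> p ! k"
  shows "2 \<le> k" "adj z y \<Longrightarrow> z \<noteq> x \<Longrightarrow> 3 \<le> k"
proof -
  note P = off_spine_step(2)[OF assms]
  show "2 \<le> k" using longest[OF P] k by simp
  assume z: "adj z y" "z \<noteq> x"
  have "path (z # y # x # drop k p)" by (rule path_Cons[OF P]) (use z in auto)
  from longest[OF this] show "3 \<le> k" using k by simp
qed

lemma reverse: "longest_path_tree V adj (rev p)"
  using path_p path_rev longest three_vertices by unfold_locales auto

lemma spine_reverse: "longest_path_tree.spine (rev p) = spine"
proof -
  interpret R: longest_path_tree V adj "rev p" by (rule reverse)
  have "R.s i = s (q - Suc i)" if "i < q" for i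
    using that length_p_q by (simp add: R.s_def s_def rev_nth Suc_diff_Suc)
  moreover have "R.q = q" by (simp add: R.q_def q_def)
  ultimately have "R.spine = (\<lambda>i. s (q - Suc i)) ` {..<q}" by (auto simp: R.spine_def)
  also have "\<dots> = s ` ((\<lambda>i. q - Suc i) ` {..<q})" by (simp add: image_image)
  also have "(\<lambda>i. q - Suc i) ` {..<q} = {..<q}"
  proof (intro equalityI subsetI)
    fix i assume "i \<in> {..<q}"
    then have "i = q - Suc (q - Suc i)" "q - Suc i \<in> {..<q}" by auto
    then show "i \<in> (\<lambda>i. q - Suc i) ` {..<q}" by (rule image_eqI)
  qed auto
  finally show ?thesis by (simp add: spine_def)
qed

text \<open>Applied to \<open>p\<close> and to \<open>rev p\<close>, the replacement argument shows
  that both parts of \<open>p\<close> on either side of \<open>s i\<close> are at least as long as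
  the branch. A branch with three vertices thus comes with two further arms of length three.\<close>

lemma dep2_interior:
  assumes i: "i < q" and x: "x \<notin> spine" "adj x (s i)" and y: "adj y x" "y \<noteq> s i"
  shows "0 < i \<and> Suc i < q" "x \<noteq> p ! i" "x \<noteq> p ! Suc (Suc i)"
    "adj z y \<Longrightarrow> z \<noteq> x \<Longrightarrow> spider"
proof -
  interpret R: longest_path_tree V adj "rev p" by (rule reverse)
  let ?k = "Suc i" and ?k' = "q - i"
  have k: "Suc ?k < length p" "0 < ?k" and k': "Suc ?k' < length (rev p)" "0 < ?k'"
    using i length_p_q by simp_all
  have s: "s i = p ! ?k" "s i = rev p ! ?k'" "rev p ! Suc ?k' = p ! i"
    using i length_p_q by (auto simp: s_def rev_nth Suc_diff_le)
  have x': "x \<notin> R.spine" using x spine_reverse by simp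
  note step = off_spine_step[OF k x(1) x(2)[unfolded s(1)] y(1) y(2)[unfolded s(1)]]
    and step' = R.off_spine_step[OF k' x' x(2)[unfolded s(2)] y(1) y(2)[unfolded s(2)]]
    and len = off_spine_step_length[OF k x(1) x(2)[unfolded s(1)] y(1) y(2)[unfolded s(1)]]
    and len' = R.off_spine_step_length[OF k' x' x(2)[unfolded s(2)] y(1) y(2)[unfolded s(2)]]
  show "0 < i \<and> Suc i < q" using len(1) len'(1) by simp
  show ne: "x \<noteq> p ! i" "x \<noteq> p ! Suc (Suc i)" using step(1) step'(1) s(3) by auto
  assume z: "adj z y" "z \<noteq> x"
  have long: "2 \<le> i" "i + 2 < q" using len(2)[OF z] len'(2)[OF z] by auto
  \<comment> \<open>As \<open>s i\<close> is \<open>p ! Suc i\<close>, the two arms along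
    \<open>p\<close> end at the indices \<open>i - 2\<close> and \<open>i + 4\<close>;
    \<open>long\<close> is just what keeps these inside \<open>p\<close>.\<close>
  define a where "a = (\<lambda>j::nat. if j = 0 then x else if j = 1 then p ! i else p ! (i + 2))"
  define b where "b = (\<lambda>j::nat. if j = 0 then y else if j = 1 then p ! (i - 1) else p ! (i + 3))"
  define c where "c = (\<lambda>j::nat. if j = 0 then z else if j = 1 then p ! (i - 2) else p ! (i + 4))"
  have pn: "p ! i \<noteq> p ! (i + 2)" using p_neq long length_p_q by simp
  have "inj_on a {..<3}" using ne pn by (auto simp: inj_on_def a_def less_Suc_eq numeral_3_eq_3)
  moreover have "adj (s i) (a j) \<and> adj (a j) (b j) \<and> adj (b j) (c j) \<and> b j \<noteq> s i \<and> c j \<noteq> a j"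
    if j: "j < 3" for j
  proof -
    consider "j = 0" | "j = 1" | "j = 2" using j by linarith
    then show ?thesis
    proof cases
      case 1
      then show ?thesis using x y z adj_sym by (simp add: a_def b_def c_def)
    next
      case 2
      have "adj (p ! i) (p ! Suc i)" using p_adj[of i] long length_p_q by simp
      moreover have "adj (p ! (i - 1)) (p ! i)" using p_adj[of "i - 1"] long length_p_q by simp
      moreover have "adj (p ! (i - 2)) (p ! (i - 1))" using p_adj[of "i - 2"] long length_p_q
        by (simp add: numeral_2_eq_2 Suc_diff_Suc)
      moreover have "p ! (i - 1) \<noteq> p ! Suc i" "p ! (i - 2) \<noteq> p ! i" using p_neq long length_p_q by simp_all
      ultimately show ?thesis using 2 adj_sym by (simp add: a_def b_def c_def s_def)
    next
      case 3
      have "adj (p ! Suc i) (p ! (i + 2))" "adj (p ! (i + 2)) (p ! (i + 3))" "adj (p ! (i + 3)) (p ! (i + 4))"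
        using p_adj[of "i + 1"] p_adj[of "i + 2"] p_adj[of "i + 3"] long length_p_q
        by (simp_all add: eval_nat_numeral)
      moreover have "p ! (i + 3) \<noteq> p ! Suc i" "p ! (i + 4) \<noteq> p ! (i + 2)"
        using p_neq long length_p_q by simp_all
      ultimately show ?thesis using 3 by (simp add: a_def b_def c_def s_def)
    qed
  qed
  ultimately show spider unfolding spider_def by blast
qed

section \<open>Positions and depths relative to the spine\<close>

text \<open>\<open>v\<close> is at distance \<open>d\<close> from the spine, with nearest spine vertex \<open>s i\<close>.\<close>

definition located :: "'a \<Rightarrow> nat \<Rightarrow> nat \<Rightarrow> bool" where
  "located v i d \<longleftrightarrow> i < q \<and>
     (d = 0 \<and> v = s i \<or>
      d = 1 \<and> v \<notin> spine \<and> adj v (s i) \<or>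
      d = 2 \<and> v \<noteq> s i \<and> (\<exists>x. x \<notin> spine \<and> adj x (s i) \<and> adj v x))"

text \<open>A second neighbour of \<open>v\<close> would be a third vertex on the branch and yield a
  spider, so every branch ends at depth 2.\<close>

lemma located2:
  assumes "\<not> spider" "located v i 2"
  obtains x where "x \<notin> spine" "adj x (s i)" "\<And>w. adj v w \<longleftrightarrow> w = x" "v \<notin> spine" "0 < i" "Suc i < q"
proof -
  from assms(2) obtain x where i: "i < q" and v: "v \<noteq> s i" and x: "x \<notin> spine" "adj x (s i)" "adj v x"
    by (auto simp: located_def)
  have "adj v w \<longleftrightarrow> w = x" for w using dep2_interior(4)[OF i x v, of w] x(3) assms(1) adj_sym by blast
  moreover have "v \<notin> spine"
    using spine_nbr_unique[OF x(1) i _ x(2)] v x(3) adj_sym by (auto simp: spine_def)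
  ultimately show ?thesis using that x dep2_interior(1)[OF i x v] by blast
qed

text \<open>The depth can be read off from \<open>v\<close> alone: 0 on the spine, 1 if off the
  spine with a spine neighbour, 2 otherwise. The position then follows from
  \<open>spine_nbr_unique\<close>, at depth 2 via the only neighbour of \<open>v\<close>.\<close>

lemma located_unique:
  assumes "\<not> spider" "located v i d" "located v j e"
  shows "i = j \<and> d = e"
proof -
  have sp: "located v i d \<Longrightarrow> v \<in> spine \<longleftrightarrow> d = 0" for i d
    using located2[OF assms(1), of v i] by (auto simp: located_def spine_def)
  have nb: "(\<exists>j<q. adj v (s j)) \<longleftrightarrow> d = 1" if l: "located v i d" "d \<noteq> 0" for i d
  proof -
    consider "d = 1" "i < q" "adj v (s i)" | "d = 2" using l by (auto simp: located_def)
    then show ?thesis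
    proof cases
      case 2
      then obtain x where x: "x \<notin> spine" "\<And>w. adj v w \<longleftrightarrow> w = x"
        using located2[OF assms(1), of v i] l by metis
      then have "\<not> (\<exists>j<q. adj v (s j))" unfolding x(2) by (auto simp: spine_def)
      with 2 show ?thesis by simp
    qed auto
  qed
  have "d \<le> 2" "e \<le> 2" using assms(2,3) by (auto simp: located_def)
  then have de: "d = e" using sp[OF assms(2)] sp[OF assms(3)] nb[OF assms(2)] nb[OF assms(3)] by auto
  have lt: "i < q" "j < q" using assms(2,3) by (auto simp: located_def)
  consider "d = 0" | "d = 1" | "d = 2" using \<open>d \<le> 2\<close> by linarith
  then have "i = j"
  proof cases
    case 1
    then have "s i = s j" using assms(2,3) de by (auto simp: located_def)
    then show ?thesis using s_inj lt by (auto simp: inj_on_def)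
  next
    case 2
    then show ?thesis using spine_nbr_unique assms(2,3) de by (auto simp: located_def)
  next
    case 3
    obtain x where x: "x \<notin> spine" "adj x (s i)" "\<And>w. adj v w \<longleftrightarrow> w = x"
      using located2 assms(1,2) 3 by metis
    obtain y where y: "y \<notin> spine" "adj y (s j)" "\<And>w. adj v w \<longleftrightarrow> w = y"
      using located2 assms(1,3) 3 de by metis
    have "x = y" using x(3) y(3) by blast
    then show ?thesis using spine_nbr_unique[OF x(1) lt x(2)] y(2) by simp
  qed
  then show ?thesis using de by simp
qed

text \<open>Serves two purposes: located vertices are closed under adjacency, hence are all of
  \<open>V\<close>, and the case distinction becomes \<open>adj_cases\<close> of the spined
  tree.\<close>

lemma located_step:
  assumes "\<not> spider" "located u i d" "adj u v"
  obtains j e where "located v j e"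
    "d = 0 \<and> e = 0 \<and> (j = Suc i \<or> i = Suc j) \<or> i = j \<and> (e = Suc d \<or> d = Suc e)"
proof -
  have i: "i < q" using assms(2) by (simp add: located_def)
  consider "d = 0" "u = s i" | "d = 1" "u \<notin> spine" "adj u (s i)" | "d = 2"
    using assms(2) by (auto simp: located_def)
  then show ?thesis
  proof cases
    case 1
    show ?thesis
    proof (cases "v \<in> spine")
      case True
      then obtain j where j: "v = s j" "j < q" by (auto simp: spine_def)
      then show ?thesis using that[of j 0] 1 spine_adj[OF i j(2)] assms(3) by (auto simp: located_def)
    next
      case False
      then show ?thesis using that[of i 1] 1 i assms(3) adj_sym by (auto simp: located_def)
    qed
  next
    case 2
    show ?thesis
    proof (cases "v = s i")
      case True
      then show ?thesis using that[of i 0] 2 i by (auto simp: located_def)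
    next
      case False
      then show ?thesis using that[of i 2] 2 i assms(3) adj_sym by (auto simp: located_def)
    qed
  next
    case 3
    then obtain x where "x \<notin> spine" "adj x (s i)" "\<And>w. adj u w \<longleftrightarrow> w = x"
      using located2 assms(1,2) by metis
    then show ?thesis using that[of i 1] 3 i assms(3) by (auto simp: located_def)
  qed
qed

lemma q_gt_0: "0 < q"
  using length_p by (simp add: q_def)

lemma s_V: "i < q \<Longrightarrow> s i \<in> V"
  using path_p length_p_q by (auto simp: path_def s_def)

lemma spined:
  assumes "\<not> spider"
  shows "\<exists>pos dep. spined_tree V adj s q pos dep"
proof -
  have "{v \<in> V. \<exists>i d. located v i d} = V"
  proof (rule connected)
    have "located (s 0) 0 0" using q_gt_0 by (simp add: located_def)
    then show "{v \<in> V. \<exists>i d. located v i d} \<noteq> {}" using s_V[OF q_gt_0] by blast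
  next
    fix u v assume u: "u \<in> {v \<in> V. \<exists>i d. located v i d}" and uv: "adj u v"
    then obtain i d where "located u i d" by blast
    from located_step[OF assms this uv] obtain j e where "located v j e" .
    then show "v \<in> {v \<in> V. \<exists>i d. located v i d}" using adj_V2[OF uv] by blast
  qed auto
  then have "\<forall>v\<in>V. \<exists>id. located v (fst id) (snd id)" by auto
  then obtain f where f: "\<And>v. v \<in> V \<Longrightarrow> located v (fst (f v)) (snd (f v))" by metis
  define pos dep where "pos v = fst (f v)" and "dep v = snd (f v)" for v
  have loc: "located v (pos v) (dep v)" if "v \<in> V" for v using f[OF that] by (simp add: pos_def dep_def)
  have eqs: "pos v = i \<and> dep v = d" if "v \<in> V" "located v i d" for v i d
    using located_unique[OF assms loc[OF that(1)] that(2)] .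
  have ends: "\<exists>v. adj (s i) v \<and> dep v = 1" if "i < q" "adj (s i) v" "v \<notin> spine" for i v
    using eqs[of v i 1] that adj_V2 adj_sym by (auto simp: located_def)
  have p_spine: "p ! k \<notin> spine" if "k = 0 \<or> k = Suc q" for k
  proof
    assume "p ! k \<in> spine"
    then obtain i where "i < q" "p ! k = p ! Suc i" by (auto simp: spine_def s_def)
    then show False using p_neq[of k "Suc i"] that length_p_q by auto
  qed
  have "spined_tree V adj s q pos dep"
  proof unfold_locales
    show "0 < q" by (rule q_gt_0)
    show "pos v < q" "dep v \<le> 2" if "v \<in> V" for v using loc[OF that] by (auto simp: located_def)
    show "s i \<in> V" if "i < q" for i using s_V that .
    show "pos (s i) = i" "dep (s i) = 0" if "i < q" for i
      using eqs[OF s_V[OF that], of i 0] that by (auto simp: located_def)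
    show "s (pos v) = v" if "v \<in> V" "dep v = 0" for v using loc[OF that(1)] that(2) by (auto simp: located_def)
    show "adj (s i) (s (Suc i))" if "Suc i < q" for i using p_adj[of "Suc i"] that by (simp add: s_def length_p_q)
    show "dep u = 0 \<and> dep v = 0 \<and> (pos v = Suc (pos u) \<or> pos u = Suc (pos v)) \<or>
      pos u = pos v \<and> (dep v = Suc (dep u) \<or> dep u = Suc (dep v))" if "adj u v" for u v
    proof -
      from located_step[OF assms loc[OF adj_V[OF that]] that] obtain j e where je: "located v j e"
        "dep u = 0 \<and> e = 0 \<and> (j = Suc (pos u) \<or> pos u = Suc j) \<or> pos u = j \<and> (e = Suc (dep u) \<or> dep u = Suc e)" .
      have "pos v = j \<and> dep v = e" by (rule eqs[OF adj_V2[OF that] je(1)])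
      then show ?thesis using je(2) by simp
    qed
    show "adj v (s (pos v))" if "v \<in> V" "dep v = 1" for v using loc[OF that(1)] that(2) by (auto simp: located_def)
    show "\<exists>!x. adj v x" "0 < pos v \<and> Suc (pos v) < q" if "v \<in> V" "dep v = 2" for v
    proof -
      have l: "located v (pos v) 2" using loc[OF that(1)] that(2) by simp
      obtain x where "\<And>w. adj v w \<longleftrightarrow> w = x" "0 < pos v" "Suc (pos v) < q"
        using located2[OF assms l] by metis
      then show "\<exists>!x. adj v x" "0 < pos v \<and> Suc (pos v) < q" by auto
    qed
    show "\<exists>v. adj (s 0) v \<and> dep v = 1"
      using ends[OF q_gt_0, of "p ! 0"] p_spine[of 0] p_adj[of 0] adj_sym by (simp add: s_def length_p_q)
    show "\<exists>v. adj (s (q - 1)) v \<and> dep v = 1"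
      using ends[of "q - 1" "p ! Suc q"] p_spine[of "Suc q"] p_adj[of q] q_gt_0 by (simp add: s_def length_p_q)
  qed
  then show ?thesis by blast
qed

end

lemma (in tree_graph) obtain_spined:
  assumes "3 \<le> card V" "\<not> spider"
  obtains s q pos dep where "spined_tree V adj s q pos dep"
proof -
  obtain p where p: "path p" "\<And>p'. path p' \<Longrightarrow> length p' \<le> length p"
    using longest_path by blast
  interpret longest_path_tree V adj p using assms p by unfold_locales auto
  show ?thesis using spined[OF assms(2)] that by blast
qed

section \<open>The game on undirected trees\<close>

text \<open>Translates the vertex lists of \<open>tree_graph\<close> into the arc lists by which
  \<open>cycle\<close> is defined.\<close>

lemma (in wf_digraph) successively_imp_awalk:
  assumes "ys \<noteq> []" "hd ys \<in> verts G" "successively (dominates G) ys"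
  shows "\<exists>p. awalk (hd ys) p (last ys) \<and> awalk_verts (hd ys) p = ys"
  using assms
proof (induction ys rule: induct_list012)
  case (2 v)
  then show ?case by (intro exI[of _ "[]"]) (simp add: awalk_Nil_iff)
next
  case (3 v w ys)
  then obtain p where p: "awalk w p (last (w # ys))" "awalk_verts w p = w # ys"
    using adj_in_verts by auto
  obtain e where "e \<in> arcs G" "tail G e = v" "head G e = w" using 3 by auto
  then show ?case using p by (intro exI[of _ "e # p"]) (auto simp: awalk_Cons_iff)
qed simp

lemma tree_graph_undirected_tree:
  assumes "undirected_tree T"
  shows "tree_graph (verts T) (dominates T)"
proof -
  interpret graph T using assms by (simp add: undirected_tree_def)
  show ?thesis
  proof unfold_locales
    show "finite (verts T)" by simp
    show "u \<in> verts T" if "u \<rightarrow>\<^bsub>T\<^esub> v" for u v using adj_in_verts that by blast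
    show "v \<rightarrow>\<^bsub>T\<^esub> u" if "u \<rightarrow>\<^bsub>T\<^esub> v" for u v using arcs_ends_symmetric[OF sym_arcs] that .
    show "\<not> v \<rightarrow>\<^bsub>T\<^esub> v" for v using adj_not_same by blast
  next
    fix xs assume xs: "distinct xs" "successively (dominates T) xs" "3 \<le> length xs"
    show "\<not> last xs \<rightarrow>\<^bsub>T\<^esub> hd xs"
    proof
      assume adj: "last xs \<rightarrow>\<^bsub>T\<^esub> hd xs"
      have ne: "xs \<noteq> []" using xs by auto
      have "successively (dominates T) (xs @ [hd xs])"
        using xs adj by (simp add: successively_append_iff)
      moreover have "hd xs \<in> verts T" using adj adj_in_verts by blast
      ultimately obtain p where p: "awalk (hd xs) p (hd xs)" "awalk_verts (hd xs) p = xs @ [hd xs]"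
        using successively_imp_awalk[of "xs @ [hd xs]"] ne by auto
      have len: "length p = length xs" using p(2) length_awalk_verts[of "hd xs" p] by simp
      have "distinct (tl (xs @ [hd xs]))" using xs ne by (cases xs) auto
      then have "cycle p" unfolding cycle_def using p len xs(3) by (intro exI[of _ "hd xs"]) auto
      then show False using assms len xs(3) by (auto simp: undirected_tree_def)
    qed
  next
    fix S assume S: "S \<subseteq> verts T" "S \<noteq> {}" "\<And>u v. u \<in> S \<Longrightarrow> u \<rightarrow>\<^bsub>T\<^esub> v \<Longrightarrow> v \<in> S"
    obtain u where u: "u \<in> S" using S by blast
    show "S = verts T"
    proof
      show "verts T \<subseteq> S"
      proof
        fix v assume "v \<in> verts T"
        then have "u \<rightarrow>\<^sup>*\<^bsub>mk_symmetric T\<^esub> v"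
          using assms u S(1) by (auto simp: undirected_tree_def connected_def strongly_connected_def)
        then have "u \<rightarrow>\<^sup>*\<^bsub>T\<^esub> v" by (simp only: reachable_mk_symmetric_eq[OF sym_arcs])
        then show "v \<in> S" by (induction rule: reachable_induct) (use u S in auto)
      qed
    qed (rule S)
  qed
qed

lemma (in nomulti_digraph) out_degree_eq_card_dominated:
  "out_degree G v = card {w. v \<rightarrow> w}"
proof -
  have "bij_betw (head G) (out_arcs G v) {w. v \<rightarrow> w}"
    unfolding bij_betw_def
    by (auto simp: inj_on_def arc_to_ends_def arcs_ends_conv intro: no_multi_arcs)
  then show ?thesis unfolding out_degree_def by (rule bij_betw_same_card)
qed

locale undirected_tree3 =
  fixes T :: "('a, 'b) pre_digraph"
  assumes undirected_tree: "undirected_tree T" and three_vertices: "3 \<le> card (verts T)"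
begin

sublocale graph T using undirected_tree by (simp add: undirected_tree_def)

sublocale T: tree_graph "verts T" "dominates T"
  by (rule tree_graph_undirected_tree[OF undirected_tree])

lemma leaves_eq: "leaves T = T.leaf_set"
  by (simp add: leaves_def T.leaf_set_def out_degree_eq_card_dominated)

lemma twigs_eq: "twigs T = T.twig_set"
  by (simp add: twigs_def T.twig_set_def leaves_eq out_degree_eq_card_dominated)

lemma ex_nbr:
  assumes "v \<in> verts T" shows "\<exists>w. v \<rightarrow>\<^bsub>T\<^esub> w"
proof (rule ccontr)
  assume "\<not> ?thesis"
  then have "{v} = verts T" using assms by (intro T.connected) auto
  then have "card (verts T) = 1" by (metis card_1_singleton_iff One_nat_def)
  then show False using three_vertices by simp
qed

text \<open>\<open>territory\<close> takes one move more than a mouse sequence, which stops at the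
  last look. This move is always possible, since a connected graph with at least three vertices has
  no isolated vertex.\<close>

lemma mouse_survives_iff:
  "mouse_survives T k \<longleftrightarrow>
    (\<forall>cs. set cs \<subseteq> verts T \<longrightarrow> length cs = k \<longrightarrow> territory (dominates T) (verts T) cs \<noteq> {})"
proof -
  have "(\<exists>ms. mouse_sequence T ms \<and> beats ms cs) \<longleftrightarrow> territory (dominates T) (verts T) cs \<noteq> {}" for cs
  proof
    assume "\<exists>ms. mouse_sequence T ms \<and> beats ms cs"
    then obtain ms where ms: "set ms \<subseteq> verts T" "successively (dominates T) ms" "length ms = length cs"
      "\<forall>i < length cs. ms ! i \<noteq> cs ! i"
      by (auto simp: mouse_sequence_def beats_def successively_conv_nth)
    have "\<exists>v. successively (dominates T) (ms @ [v]) \<and> hd (ms @ [v]) \<in> verts T"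
    proof (cases "ms = []")
      case True
      obtain v where "v \<in> verts T" using three_vertices by fastforce
      then show ?thesis using True by auto
    next
      case False
      then obtain v where "last ms \<rightarrow>\<^bsub>T\<^esub> v" using ex_nbr ms(1) last_in_set by blast
      then show ?thesis using ms False by (auto simp: successively_append_iff)
    qed
    then obtain v where "successively (dominates T) (ms @ [v])" "hd (ms @ [v]) \<in> verts T" by blast
    then have "v \<in> territory (dominates T) (verts T) cs"
      unfolding territory_iff_walk using ms by (intro exI[of _ ms]) simp
    then show "territory (dominates T) (verts T) cs \<noteq> {}" by blast
  next
    assume "territory (dominates T) (verts T) cs \<noteq> {}"
    then obtain v ms where ms: "length ms = length cs" "successively (dominates T) (ms @ [v])"
      "\<forall>i < length cs. ms ! i \<noteq> cs ! i" by (auto simp: ex_in_conv[symmetric] territory_iff_walk)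
    have adj: "(ms @ [v]) ! i \<rightarrow>\<^bsub>T\<^esub> (ms @ [v]) ! Suc i" if "i < length ms" for i
      using successively_nth[OF ms(2), of i] that by simp
    have "set ms \<subseteq> verts T"
    proof
      fix u assume "u \<in> set ms"
      then obtain i where "i < length ms" "u = (ms @ [v]) ! i" by (auto simp: in_set_conv_nth nth_append)
      then show "u \<in> verts T" using adj adj_in_verts by blast
    qed
    moreover have "successively (dominates T) ms" using ms(2) by (simp add: successively_append_iff)
    ultimately show "\<exists>ms. mouse_sequence T ms \<and> beats ms cs"
      using ms(1,3) by (auto simp: mouse_sequence_def beats_def successively_conv_nth)
  qed
  then show ?thesis by (auto simp: mouse_survives_def cat_sequence_def)
qed

lemma mouse_number_eqI:
  assumes "1 \<le> k" "\<exists>cs. set cs \<subseteq> verts T \<and> length cs = k \<and> territory (dominates T) (verts T) cs = {}"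
    and "\<And>cs. set cs \<subseteq> verts T \<Longrightarrow> territory (dominates T) (verts T) cs = {} \<Longrightarrow> k \<le> length cs"
  shows "mouse_number T = enat k"
proof -
  have k: "1 \<le> k \<and> \<not> mouse_survives T k" using assms(1,2) by (auto simp: mouse_survives_iff)
  moreover have "(LEAST k. 1 \<le> k \<and> \<not> mouse_survives T k) = k"
    using k assms(3) by (intro Least_equality) (auto simp: mouse_survives_iff)
  ultimately show ?thesis unfolding mouse_number_def by auto
qed

lemma length_ge_2:
  assumes "territory (dominates T) (verts T) cs = {}"
  shows "2 \<le> length cs"
proof (rule ccontr)
  assume "\<not> 2 \<le> length cs"
  then consider "cs = []" | c where "cs = [c]" by (cases cs rule: remdups_adj.cases) auto
  moreover have "\<exists>v\<in>verts T. v \<noteq> c" for c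
  proof (rule ccontr)
    assume "\<not> ?thesis"
    then have "card (verts T) \<le> card {c}" by (intro card_mono) auto
    then show False using three_vertices by simp
  qed
  ultimately show False using assms ex_nbr by cases fastforce+
qed

lemma mouse_number_star:
  assumes "is_star T" shows "mouse_number T = 2"
proof -
  obtain U W where UW: "verts T = U \<union> W" "U \<inter> W = {}" "card U = 1" "arcs_ends T = U \<times> W \<union> W \<times> U"
    using assms by (auto simp: is_star_def complete_bipartite_digraph_def)
  then obtain c where "U = {c}" by (auto simp: card_1_singleton_iff)
  \<comment> \<open>A mouse missed by the first look is not at the centre and has to move
    there.\<close>
  then have "territory (dominates T) (verts T) [c, c] = {}" "c \<in> verts T" using UW by auto
  moreover have "set [c, c] \<subseteq> verts T" "length [c, c] = 2" using calculation(2) by simp_all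
  ultimately have "\<exists>cs. set cs \<subseteq> verts T \<and> length cs = 2 \<and> territory (dominates T) (verts T) cs = {}"
    by blast
  then have "mouse_number T = enat 2"
    using length_ge_2 by (intro mouse_number_eqI) auto
  then show ?thesis by (simp add: numeral_eq_enat)
qed

section \<open>Spiders as copies of T* and the infinite case\<close>

lemma spider_if_contains_tstar:
  assumes "contains_subgraph T (with_proj tstar)" shows T.spider
proof -
  obtain h where h: "pre_digraph.digraph_isomorphism (with_proj tstar) h"
    "subgraph (app_iso h (with_proj tstar)) T"
    using assms by (auto simp: contains_subgraph_def digraph_iso_def)
  define f where "f = iso_verts h"
  have inj: "inj_on f {0..9}"
    using h(1) by (simp add: pre_digraph.digraph_isomorphism_def f_def tstar_def)
  have adj: "f i \<rightarrow>\<^bsub>T\<^esub> f j" if "(i, j) \<in> parcs tstar" for i j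
  proof -
    let ?e = "iso_arcs h (i, j)"
    have "?e \<in> arcs T" "tail T ?e = iso_tail h ?e" "head T ?e = iso_head h ?e"
      using h(2) that by (auto simp: subgraph_def compatible_def app_iso_def)
    moreover have "iso_tail h ?e = f i" "iso_head h ?e = f j"
      using h(1) that by (fastforce simp: pre_digraph.digraph_isomorphism_def f_def)+
    ultimately show ?thesis by (auto simp: arcs_ends_conv image_iff intro!: bexI[of _ ?e])
  qed
  have ne: "f i \<noteq> f j" if "i \<le> 9" "j \<le> 9" "i \<noteq> j" for i j
    using inj that by (auto simp: inj_on_def)
  \<comment> \<open>In the numbering of \<open>tstar\<close>, arm \<open>i\<close> consists of
    \<open>3 * i + 1\<close>, \<open>3 * i + 2\<close>, \<open>3 * i + 3\<close>, read outwards from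
    the centre 0.\<close>
  define a b c where "a i = f (3 * i + 1)" and "b i = f (3 * i + 2)" and "c i = f (3 * i + 3)" for i
  have "inj_on a {..<3}" by (rule inj_onI, rule ccontr) (use ne in \<open>auto simp: a_def\<close>)
  moreover have "f 0 \<rightarrow>\<^bsub>T\<^esub> a i \<and> a i \<rightarrow>\<^bsub>T\<^esub> b i \<and> b i \<rightarrow>\<^bsub>T\<^esub> c i \<and> b i \<noteq> f 0 \<and> c i \<noteq> a i" if i: "i < 3" for i
  proof -
    consider "i = 0" | "i = 1" | "i = 2" using i by linarith
    then show ?thesis
      by cases (simp_all add: a_def b_def c_def adj ne tstar_def tstar_edges_def)
  qed
  ultimately show ?thesis unfolding T.spider_def by blast
qed

lemma mouse_number_spider:
  assumes T.spider shows "mouse_number T = \<infinity>"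
proof -
  obtain z a b c where a: "inj_on a {..<3::nat}" and adj: "\<And>i. i < 3 \<Longrightarrow>
    z \<rightarrow>\<^bsub>T\<^esub> a i \<and> a i \<rightarrow>\<^bsub>T\<^esub> b i \<and> b i \<rightarrow>\<^bsub>T\<^esub> c i \<and> b i \<noteq> z \<and> c i \<noteq> a i"
    using assms unfolding T.spider_def by blast
  have dist: "distinct [c i, b i, a i, z, a j, b j, c j]" if "i < 3" "j < 3" "i \<noteq> j" for i j
    using T.spider_distinct[OF a adj that] .
  have "territory (dominates T) (verts T) cs \<noteq> {}" for cs
  proof (rule T.tstar_territory)
    show "z \<rightarrow>\<^bsub>T\<^esub> a i \<and> a i \<rightarrow>\<^bsub>T\<^esub> b i \<and> b i \<rightarrow>\<^bsub>T\<^esub> c i" if "i < 3" for i using adj[OF that] by simp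
    show "inj_on a {..<3}" by (rule a)
    show "inj_on b {..<3}" "inj_on c {..<3}"
      by (rule inj_onI, rule ccontr; use dist in force)+
    show "b i \<noteq> z" if "i < 3" for i using adj[OF that] by simp
    show "c i \<noteq> a j" if "i < 3" "j < 3" for i j
      using dist[OF that] adj[OF that(1)] by (cases "i = j") auto
  qed
  then show ?thesis by (simp add: mouse_number_def mouse_survives_iff)
qed

lemma contains_tstar_if_spider:
  assumes T.spider shows "contains_subgraph T (with_proj tstar)"
proof -
  obtain z a b c where a: "inj_on a {..<3::nat}" and adj: "\<And>i. i < 3 \<Longrightarrow>
    z \<rightarrow>\<^bsub>T\<^esub> a i \<and> a i \<rightarrow>\<^bsub>T\<^esub> b i \<and> b i \<rightarrow>\<^bsub>T\<^esub> c i \<and> b i \<noteq> z \<and> c i \<noteq> a i"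
    using assms unfolding T.spider_def by blast
  have dist: "distinct [c i, b i, a i, z, a j, b j, c j]" if "i < 3" "j < 3" "i \<noteq> j" for i j
    using T.spider_distinct[OF a adj that] .
  \<comment> \<open>Ordered so that the index in \<open>xs\<close> is the vertex number in
    \<open>tstar\<close>.\<close>
  define xs where "xs = [z, a 0, b 0, c 0, a 1, b 1, c 1, a 2, b 2, c 2]"
  have xs: "distinct xs"
    using dist[of 0 1] dist[of 0 2] dist[of 1 2] by (auto simp: xs_def)
  have xs_adj: "xs ! i \<rightarrow>\<^bsub>T\<^esub> xs ! j" if "(i, j) \<in> parcs tstar" for i j
  proof -
    have "xs ! i \<rightarrow>\<^bsub>T\<^esub> xs ! j" if "(i, j) \<in> tstar_edges" for i j
      using that adj[of 0] adj[of 1] adj[of 2] by (auto simp: tstar_edges_def xs_def)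
    then show ?thesis using that T.adj_sym unfolding tstar_def by auto
  qed
  define arc where "arc ij = (SOME e. e \<in> arcs T \<and> tail T e = xs ! fst ij \<and> head T e = xs ! snd ij)" for ij
  have arc: "arc ij \<in> arcs T \<and> tail T (arc ij) = xs ! fst ij \<and> head T (arc ij) = xs ! snd ij"
    if "ij \<in> parcs tstar" for ij
    unfolding arc_def by (rule someI_ex) (use xs_adj[of "fst ij" "snd ij"] that in \<open>auto simp: arcs_ends_conv\<close>)
  have verts: "i \<le> 9 \<and> j \<le> 9" if "(i, j) \<in> parcs tstar" for i j
    using that by (auto simp: tstar_def tstar_edges_def)
  have inj: "inj_on ((!) xs) {0..9}" by (rule inj_on_nth[OF xs]) (simp add: xs_def)
  interpret S: wf_digraph "with_proj tstar"
    by unfold_locales (auto simp: tstar_def tstar_edges_def)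
  \<comment> \<open>Taking head and tail from \<open>T\<close> makes the image compatible with
    \<open>T\<close> by construction; \<open>arc\<close> supplies actual arcs of \<open>T\<close>
    for the pairs in \<open>tstar\<close>.\<close>
  define h where "h = \<lparr>iso_verts = (!) xs, iso_arcs = arc, iso_head = head T, iso_tail = tail T\<rparr>"
  have "inj_on arc (parcs tstar)"
  proof (rule inj_onI)
    fix ij kl assume ij: "ij \<in> parcs tstar" and kl: "kl \<in> parcs tstar" and "arc ij = arc kl"
    then have "xs ! fst ij = xs ! fst kl" "xs ! snd ij = xs ! snd kl" using arc by metis+
    moreover have "fst ij \<in> {0..9}" "snd ij \<in> {0..9}" "fst kl \<in> {0..9}" "snd kl \<in> {0..9}"
      using verts[of "fst ij" "snd ij"] verts[of "fst kl" "snd kl"] ij kl by auto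
    ultimately show "ij = kl" using inj by (auto simp: inj_on_def prod_eq_iff)
  qed
  then have h: "S.digraph_isomorphism h"
    unfolding S.digraph_isomorphism_def
    using inj arc S.wf_digraph by (auto simp: h_def tstar_def)
  have "set xs \<subseteq> verts T"
    using adj[of 0] adj[of 1] adj[of 2] T.adj_V T.adj_V2 unfolding xs_def by auto
  moreover have "length xs = 10" by (simp add: xs_def)
  then have "(!) xs ` {0..9} \<subseteq> set xs" by (auto intro!: nth_mem)
  ultimately have "subgraph (app_iso h (with_proj tstar)) T"
    unfolding subgraph_def compatible_def
    using arc S.wf_digraphI_app_iso[OF h] wf_digraph by (auto simp: h_def tstar_def)
  then show ?thesis using h by (auto simp: contains_subgraph_def digraph_iso_def)
qed

lemma mouse_number_spined:
  assumes "spined_tree (verts T) (dominates T) s q pos dep" "\<not> is_star T"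
  shows "\<exists>k. mouse_number T = enat k \<and>
    int k = 2 * int (card (verts T)) + 2 * int (card (twigs T)) - 2 * int (card (leaves T)) - 4"
proof -
  interpret S: spined_tree "verts T" "dominates T" s q pos dep by (rule assms(1))
  \<comment> \<open>With a single spine vertex, \<open>pos_dep2\<close> rules out depth 2, so all
    other vertices hang directly on \<open>s 0\<close> and the tree is a star.\<close>
  have "2 \<le> q"
  proof (rule ccontr)
    assume "\<not> 2 \<le> q"
    then have q: "q = 1" using S.q_pos by simp
    have pos: "pos v = 0" if "v \<in> verts T" for v using S.pos_less[OF that] q by simp
    have centre: "v = s 0" if "v \<in> verts T" "dep v = 0" for v using S.spine_eq[OF that] pos[OF that(1)] by simp
    have dep: "dep v = 0 \<or> dep v = 1" if v: "v \<in> verts T" for v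
      using S.dep_le[OF v] S.pos_dep2[OF v] pos[OF v] by (cases "dep v = 2") auto
    have s0: "s 0 \<in> verts T" "dep (s 0) = 0" using S.s_V S.dep_s q by auto
    have ends: "arcs_ends T = {s 0} \<times> (verts T - {s 0}) \<union> (verts T - {s 0}) \<times> {s 0}" (is "_ = ?R")
    proof (intro equalityI subrelI)
      fix u v assume uv: "u \<rightarrow>\<^bsub>T\<^esub> v"
      have "u \<in> verts T" "v \<in> verts T" "u \<noteq> v" using adj_in_verts[OF uv] T.adj_irrefl uv by auto
      moreover have "dep u = 0 \<or> dep v = 0"
        using S.adj_cases[OF uv] dep[OF calculation(1)] dep[OF calculation(2)] by auto
      ultimately show "(u, v) \<in> ?R" using centre by auto
    next
      fix u v assume uv: "(u, v) \<in> ?R"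
      have "w \<rightarrow>\<^bsub>T\<^esub> s 0" if "w \<in> verts T - {s 0}" for w
        using S.adj_dep1[of w] dep[of w] centre[of w] pos[of w] that by auto
      then show "u \<rightarrow>\<^bsub>T\<^esub> v" using uv T.adj_sym by auto
    qed
    have "graph T" by unfold_locales
    moreover have "verts T = {s 0} \<union> (verts T - {s 0})" using s0 by blast
    moreover have "{s 0} \<inter> (verts T - {s 0}) = {}" "card {s 0} = 1" by simp_all
    ultimately have "complete_bipartite_digraph 1 (card (verts T - {s 0})) T"
      unfolding complete_bipartite_digraph_def using ends by blast
    then show False using assms(2) by (auto simp: is_star_def)
  qed
  from S.mouse_bounds[OF this] obtain k where k:
    "int k = 2 * int (card (verts T)) + 2 * int (card T.twig_set) - 2 * int (card T.leaf_set) - 4"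
    "2 \<le> k" "\<exists>cs. set cs \<subseteq> verts T \<and> length cs = k \<and> territory (dominates T) (verts T) cs = {}"
    "\<And>cs. set cs \<subseteq> verts T \<Longrightarrow> territory (dominates T) (verts T) cs = {} \<Longrightarrow> k \<le> length cs"
    by metis
  have "mouse_number T = enat k" by (rule mouse_number_eqI[OF _ k(3,4)]) (use k(2) in simp_all)
  then show ?thesis using k(1) by (auto simp: leaves_eq twigs_eq)
qed

end

theorem theorem1:
  fixes T :: "('a, 'b) pre_digraph" and n t l :: nat
  assumes "undirected_tree T"
    and "n = card (verts T)" and "n \<ge> 3"
    and "t = card (twigs T)" and "l = card (leaves T)"
  shows "(contains_subgraph T (with_proj tstar) \<longrightarrow> mouse_number T = \<infinity>) \<and>
         (is_star T \<longrightarrow> mouse_number T = 2) \<and>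
         (\<not> contains_subgraph T (with_proj tstar) \<and> \<not> is_star T \<longrightarrow>
           (\<exists>k. mouse_number T = enat k \<and>
                int k = 2 * int n + 2 * int t - 2 * int l - 4))"
proof -
  interpret undirected_tree3 T using assms by unfold_locales auto
  have "\<exists>k. mouse_number T = enat k \<and> int k = 2 * int n + 2 * int t - 2 * int l - 4"
    if "\<not> contains_subgraph T (with_proj tstar)" "\<not> is_star T"
  proof -
    have "\<not> T.spider" using contains_tstar_if_spider that by blast
    then obtain s q pos dep where "spined_tree (verts T) (dominates T) s q pos dep"
      using T.obtain_spined[OF three_vertices] by metis
    from mouse_number_spined[OF this that(2)] show ?thesis using assms by simp
  qed
  then show ?thesis using spider_if_contains_tstar mouse_number_spider mouse_number_star by blast
qed

end
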